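(* Consider stage $i$ ($1\le i\le s$) of the DG-IMEX scheme described in the context. Assume: 1. For all $\ell=1,\dots,d$, the $M_x$-point Legendre--Gauss--Lobatto (LGL) quadrature on $K^\ell$ is exact for computing the cell average of $\mathbf U_h^{(j)}$ over $K^\ell$. 2. The $M_\varepsilon$-point LGL quadrature on $K_\varepsilon$ is exact for computing the ($\varepsilon^2$-weighted) cell average of $\mathbf U_h^{(j)}$ over $K_\varepsilon$. 3. For all $0\le j\le i-1<s$, the values of $\mathbf U_h^{(j)}$ at all points of $\widetilde S_\otimes(\mathbf K)$, for all elements $\mathbf K$, lie in $\mathcal R$. 4. The time step satisfies $$\Delta t\le \hat c\,\min_{K_\varepsilon,K^\ell}\Big\{\,W(1-v)\frac{\hat w^\varepsilon_{M_\varepsilon}\Delta\varepsilon}{(d+1)\,\varepsilon_{\rm H}\,a^\varepsilon},\ \frac{\hat w^\ell_{M_x}\Delta x^\ell}{(d+1)\,a^\ell}\Big\},$$ with $a^\varepsilon\ge|q|$, $a^\ell\ge1$, and $\hat c=\min_{i,j}1/\hat c_{ij}$. Then $\mathbf U^{(i)}_{\rm Ex}\in\mathcal R$.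
   Context: **Kinematics.** Units $c=1$, metric $\eta=\mathrm{diag}(-1,1,1,1)$. The three-velocity $v^i(\boldsymbol x)$ is time independent, $v=\sqrt{v_iv^i}<1$, $W=(1-v^2)^{-1/2}$, $u^\mu=W(1,v^i)$, $n^\mu=(1,0,0,0)$, $v^\mu=(0,v^i)$. For $\omega=(\vartheta,\varphi)\in\mathbb S^2$ put $\ell^{\hat\imath}=(\cos\vartheta,\sin\vartheta\cos\varphi,\sin\vartheta\sin\varphi)$ and let $\ell^\mu$ be its Lorentz boost: $\ell^0=W v_j\ell^{\hat\jmath}$, $\ell^i=\ell^{\hat\imath}+(W-1)v^i(v_j\ell^{\hat\jmath})/v^2$ ($\ell^i=\ell^{\hat\imath}$ if $v=0$), so $u_\mu\ell^\mu=0$, $\ell_\mu\ell^\mu=1$. For $\varepsilon>0$: $p^\mu=\varepsilon(u^\mu+\ell^\mu)$, $E=-n_\mu p^\mu=\varepsilon(W+v_\mu\ell^\mu)>0$, and $L^\mu$ is defined by $p^\mu=E(n^\mu+L^\mu)$, so $L^0=0$, $L_iL^i=1$. Put $q=p^\nu p^\rho\partial_\nu u_\rho/\varepsilon^2$, with $\partial_\nu u_\rho$ replaced by the given (discrete) four-velocity gradient; $a^\varepsilon(\boldsymbol x)\ge|q|$ means for all $\omega$. **Realizability.** $\mathfrak R$ is the set of integrable $f\ge0$ on $\mathbb S^2$ with $\frac1{4\pi}\int_{\mathbb S^2}f\,d\omega>0$. An Eulerian pair $\mathbf U=(\mathcal E,\mathcal F_j)$ (with $\mathcal F_0=0$) is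 in $\mathcal R$ (realizable) if $\mathcal E>0$ and $\mathcal E\ge\sqrt{\mathcal F_j\mathcal F^j}$. **Exact closure (standing assumption).** Each realizable moment value is closed by some $f\in\mathfrak R$ such that $$\mathbf U=\tfrac1{4\pi}\!\int\tfrac{E^2}{\varepsilon}f\,(1,L_j)\,d\omega,\quad \mathbf F^i=\tfrac1{4\pi}\!\int\tfrac{E^2}{\varepsilon}fL^i(1,L_j)\,d\omega,$$ $$\widetilde{\mathbf U}=\tfrac1{4\pi}\!\int Ef\,(1,L_j)\,d\omega,\quad \mathbf F^\varepsilon=-\tfrac1{4\pi}\!\int qEf\,(1,L_j)\,d\omega .$$ **Mesh and quadrature.** $\Omega_\varepsilon\times\Omega_{\boldsymbol x}\subset\mathbb R^+\times\mathbb R^d$ is divided into elements $\mathbf K=K_\varepsilon\times\mathbf K_{\boldsymbol x}$, $\mathbf K_{\boldsymbol x}=K^1\times\dots\times K^d$, $K_\varepsilon=(\varepsilon_{\rm L},\varepsilon_{\rm H})$, $K^\ell=(x^\ell_{\rm L},x^\ell_{\rm H})$, $\Delta\varepsilon=\varepsilon_{\rm H}-\varepsilon_{\rm L}$, $\Delta x^\ell=x^\ell_{\rm H}-x^\ell_{\rm L}$; $|K_\varepsilon|=\int_{K_\varepsilon}\varepsilon^2d\varepsilon$, $|\mathbf K_{\boldsymbol x}|=\prod_\ell\Delta x^\ell$, $|\mathbf K|=|K_\varepsilon||\mathbf K_{\boldsymbol x}|$, $\widetilde{\mathbf K}^\ell=K_\varepsilon\times\prod_{j\ne\ell}K^j$.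 $\mathbf U_h$ is, on each element, a tensor-product polynomial of degree $\le k$ in each of $\varepsilon,x^1,\dots,x^d$. $M_\varepsilon\ge(k+5)/2$ and $M_x\ge(k+3)/2$ LGL points (element endpoints included) are used on $K_\varepsilon$ and $K^\ell$, with weights $\hat w^\varepsilon_q$, $\hat w^\ell_q$ normalized to sum to 1. $S_\otimes(\mathbf K)$ is the tensor product of $N$-point Legendre--Gauss (LG) points in all dimensions; $\hat S_{\varepsilon,\otimes}(\mathbf K)$ (resp. $\hat S_{\ell,\otimes}(\mathbf K)$) is the same set with LG points in the $\varepsilon$ (resp. $x^\ell$) dimension replaced by the LGL points; $\widetilde S_\otimes(\mathbf K)$ is the union of all these sets. Face integrals are evaluated with the tensor LG quadrature, taken exact for the polynomials in the cell averages. Traces exterior to the domain (boundary data) are realizable. **Fluxes.** $\widehat{\mathbf F}^\ell=\frac12[\mathbf F^\ell|_{x^-}+\mathbf F^\ell|_{x^+}-a^\ell(\mathbf U_h|_{x^+}-\mathbf U_h|_{x^-})]$ and $\widehat{\mathbf F}^\varepsilon=\frac12[\mathbf F^\varepsilon|_{\varepsilon^-}+\mathbf F^\varepsilon|_{\varepsilon^+}-a^\varepsilon(\widetilde{\mathbf U}|_{\varepsilon^+}-\widetilde{\mathbf U}|_{\varepsilon^-})]$, where $\pm$ denote one-sided traces. **Explicit update.** $\mathbf U_{\mathbf K}=\frac1{|\mathbf K|}\int_{\mathbf K}\mathbf U_h\varepsilon^2d\varepsilon\,d\boldsymbol x$. With $c_{ij}\ge0$, $\sum_{j=0}^{i-1}c_{ij}=1$,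 $\hat c_{ij}\ge0$: $$\mathbf U^{(ij)}_{\mathbf K}=\mathbf U^{(j)}_{\mathbf K}+\hat c_{ij}\Delta t\,\mathbf T(\mathbf U_h^{(j)})_{\mathbf K},\qquad \mathbf U^{(i)}_{\rm Ex}=\sum_{j=0}^{i-1}c_{ij}\mathbf U^{(ij)}_{\mathbf K},$$ $$\mathbf T(\mathbf U_h)_{\mathbf K}=-\tfrac1{|\mathbf K|}\int_{\mathbf K_{\boldsymbol x}}[\varepsilon^3\widehat{\mathbf F}^\varepsilon|_{\varepsilon_{\rm H}}-\varepsilon^3\widehat{\mathbf F}^\varepsilon|_{\varepsilon_{\rm L}}]d\boldsymbol x-\sum_{\ell=1}^d\tfrac1{|\mathbf K|}\int_{\widetilde{\mathbf K}^\ell}[\widehat{\mathbf F}^\ell|_{x^\ell_{\rm H}}-\widehat{\mathbf F}^\ell|_{x^\ell_{\rm L}}]\varepsilon^2d\tilde{\boldsymbol z}^\ell,$$ where $\tilde{\boldsymbol z}^\ell$ are the coordinates on $\widetilde{\mathbf K}^\ell$. *)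

theory Defs
  imports "HOL-Analysis.Analysis" "HOL-Computational_Algebra.Polynomial"
begin

section \<open>Legendre--Gauss and Legendre--Gauss--Lobatto rules on \<open>[-1, 1]\<close>\<close>

fun legendre :: "nat \<Rightarrow> real poly" where
  "legendre 0 = 1"
| "legendre (Suc 0) = [:0, 1:]"
| "legendre (Suc (Suc n)) =
     smult (1 / (real n + 2))
       (smult (2 * real n + 3) ([:0, 1:] * legendre (Suc n)) - smult (real n + 1) (legendre n))"

definition lg_nodes :: "nat \<Rightarrow> real set" where
  "lg_nodes N = {x. poly (legendre N) x = 0}"

text \<open>Weights of both rules are half of the textbook weights on \<open>[-1, 1]\<close>, so that they sum
  to \<open>1\<close>. They are functions of the node; the last LGL weight is the weight of the node \<open>1\<close>.\<close>

definition lg_weight :: "nat \<Rightarrow> real \<Rightarrow> real" where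
  "lg_weight N x = 1 / ((1 - x\<^sup>2) * (poly (pderiv (legendre N)) x)\<^sup>2)"

definition lgl_nodes :: "nat \<Rightarrow> real set" where
  "lgl_nodes M = {-1, 1} \<union> {x. poly (pderiv (legendre (M - 1))) x = 0}"

definition lgl_weight :: "nat \<Rightarrow> real \<Rightarrow> real" where
  "lgl_weight M x = 1 / (real M * (real M - 1) * (poly (legendre (M - 1)) x)\<^sup>2)"

definition lg_exact :: "nat \<Rightarrow> nat \<Rightarrow> bool" where
  "lg_exact N n \<longleftrightarrow>
     (\<forall>p::real poly. degree p \<le> n \<longrightarrow>
        (1/2) * (LBINT x:{-1..1}. poly p x) = (\<Sum>x\<in>lg_nodes N. lg_weight N x * poly p x))"

section \<open>Kinematics\<close>

text \<open>A four-vector is a pair of its time component and its spatial components.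
  Spatial index \<open>i \<in> {1, 2, 3}\<close> is \<open>of_nat i\<close> in the index type \<open>3\<close> (where \<open>3 = 0\<close>).\<close>

type_synonym four = "real \<times> (real^3)"

definition mink :: "four \<Rightarrow> four \<Rightarrow> real" where
  "mink a b = - fst a * fst b + snd a \<bullet> snd b"

definition comp :: "four \<Rightarrow> nat \<Rightarrow> real" where
  "comp a \<mu> = (if \<mu> = 0 then fst a else snd a $ of_nat \<mu>)"

definition nvec :: four where
  "nvec = (1, 0)"

definition lorentz :: "real^3 \<Rightarrow> real" where
  "lorentz v = 1 / sqrt (1 - (norm v)\<^sup>2)"

definition fourvel :: "real^3 \<Rightarrow> four" where
  "fourvel v = lorentz v *\<^sub>R (1, v)"

definition unit_dir :: "real \<times> real \<Rightarrow> real^3" where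
  "unit_dir \<omega> = (case \<omega> of (\<theta>, \<phi>) \<Rightarrow> vector [cos \<theta>, sin \<theta> * cos \<phi>, sin \<theta> * sin \<phi>])"

definition boosted_dir :: "real^3 \<Rightarrow> real \<times> real \<Rightarrow> four" where
  "boosted_dir v \<omega> =
     (lorentz v * (v \<bullet> unit_dir \<omega>),
      if v = 0 then unit_dir \<omega>
      else unit_dir \<omega> + ((lorentz v - 1) * (v \<bullet> unit_dir \<omega>) / (norm v)\<^sup>2) *\<^sub>R v)"

definition momentum :: "real^3 \<Rightarrow> real \<Rightarrow> real \<times> real \<Rightarrow> four" where
  "momentum v \<epsilon> \<omega> = \<epsilon> *\<^sub>R (fourvel v + boosted_dir v \<omega>)"

definition energy :: "real^3 \<Rightarrow> real \<Rightarrow> real \<times> real \<Rightarrow> real" where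
  "energy v \<epsilon> \<omega> = - mink nvec (momentum v \<epsilon> \<omega>)"

definition Ldir :: "real^3 \<Rightarrow> real \<Rightarrow> real \<times> real \<Rightarrow> four" where
  "Ldir v \<epsilon> \<omega> = (1 / energy v \<epsilon> \<omega>) *\<^sub>R momentum v \<epsilon> \<omega> - nvec"

text \<open>\<open>G \<nu> \<rho>\<close> stands for the (discrete) gradient component \<open>\<partial>\<^sub>\<nu> u\<^sub>\<rho>\<close>, with lower indices.\<close>

definition qfun :: "real^3 \<Rightarrow> (nat \<Rightarrow> nat \<Rightarrow> real) \<Rightarrow> real \<Rightarrow> real \<times> real \<Rightarrow> real" where
  "qfun v G \<epsilon> \<omega> =
     (\<Sum>\<nu>\<le>3. \<Sum>\<rho>\<le>3. comp (momentum v \<epsilon> \<omega>) \<nu> * comp (momentum v \<epsilon> \<omega>) \<rho> * G \<nu> \<rho>) / \<epsilon>\<^sup>2"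

section \<open>Angular moments and realizability\<close>

text \<open>The sphere is parametrized by \<open>(\<theta>, \<phi>)\<close> and carries the surface measure
  \<open>sin \<theta> d\<theta> d\<phi>\<close>.\<close>

definition angles :: "(real \<times> real) set" where
  "angles = {0..pi} \<times> {0..<2 * pi}"

definition sphere_measure :: "(real \<times> real) measure" where
  "sphere_measure = density lborel (\<lambda>\<omega>. ennreal (indicator angles \<omega> * sin (fst \<omega>)))"

definition sphere_mean :: "(real \<times> real \<Rightarrow> 'a::euclidean_space) \<Rightarrow> 'a" where
  "sphere_mean h = (1 / (4 * pi)) *\<^sub>R (LINT \<omega>|sphere_measure. h \<omega>)"

definition densities :: "(real \<times> real \<Rightarrow> real) set" where
  "densities = {f. integrable sphere_measure f \<and> (\<forall>\<omega>\<in>angles. f \<omega> \<ge> 0) \<and> sphere_mean f > 0}"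

text \<open>A moment pair \<open>(\<E>, \<F>\<^sub>j)\<close> without the vanishing component \<open>\<F>\<^sub>0\<close>.\<close>

type_synonym state = "real \<times> (real^3)"

definition realizable :: "state set" where
  "realizable = {(e, F). e > 0 \<and> e \<ge> sqrt (F \<bullet> F)}"

definition oneL :: "real^3 \<Rightarrow> real \<Rightarrow> real \<times> real \<Rightarrow> state" where
  "oneL v \<epsilon> \<omega> = (1, snd (Ldir v \<epsilon> \<omega>))"

definition mom_U :: "real^3 \<Rightarrow> real \<Rightarrow> (real \<times> real \<Rightarrow> real) \<Rightarrow> state" where
  "mom_U v \<epsilon> f = sphere_mean (\<lambda>\<omega>. ((energy v \<epsilon> \<omega>)\<^sup>2 / \<epsilon> * f \<omega>) *\<^sub>R oneL v \<epsilon> \<omega>)"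

definition mom_F :: "real^3 \<Rightarrow> real \<Rightarrow> (real \<times> real \<Rightarrow> real) \<Rightarrow> nat \<Rightarrow> state" where
  "mom_F v \<epsilon> f i =
     sphere_mean (\<lambda>\<omega>. ((energy v \<epsilon> \<omega>)\<^sup>2 / \<epsilon> * f \<omega> * comp (Ldir v \<epsilon> \<omega>) i) *\<^sub>R oneL v \<epsilon> \<omega>)"

definition mom_Utilde :: "real^3 \<Rightarrow> real \<Rightarrow> (real \<times> real \<Rightarrow> real) \<Rightarrow> state" where
  "mom_Utilde v \<epsilon> f = sphere_mean (\<lambda>\<omega>. (energy v \<epsilon> \<omega> * f \<omega>) *\<^sub>R oneL v \<epsilon> \<omega>)"

definition mom_Feps ::
    "real^3 \<Rightarrow> (nat \<Rightarrow> nat \<Rightarrow> real) \<Rightarrow> real \<Rightarrow> (real \<times> real \<Rightarrow> real) \<Rightarrow> state" where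
  "mom_Feps v G \<epsilon> f =
     - sphere_mean (\<lambda>\<omega>. (qfun v G \<epsilon> \<omega> * energy v \<epsilon> \<omega> * f \<omega>) *\<^sub>R oneL v \<epsilon> \<omega>)"

section \<open>Mesh and quadrature points\<close>

text \<open>A phase-space point is a function \<open>z\<close> on \<open>{0..d}\<close> with \<open>z 0 = \<epsilon>\<close> and \<open>z l = x\<^sup>l\<close> for
  \<open>1 \<le> l \<le> d\<close>; a spatial point is such a function on \<open>{1..d}\<close>. An element is given by its lower and
  upper corner. A field assigns to every element a function (a polynomial) on all of phase space, so
  that its one-sided traces on faces are the values there.\<close>

type_synonym point = "nat \<Rightarrow> real"
type_synonym element = "point \<times> point"
type_synonym field = "element \<Rightarrow> point \<Rightarrow> state"

record dg_scheme =
  space_dim :: nat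
  polydeg :: nat
  lg_num :: nat
  lgl_num_eps :: nat
  lgl_num_x :: nat
  mesh :: "element set"
  vel :: "point \<Rightarrow> real^3"
  grad_u :: "point \<Rightarrow> nat \<Rightarrow> nat \<Rightarrow> real"
  closure_f :: "real \<Rightarrow> point \<Rightarrow> state \<Rightarrow> real \<times> real \<Rightarrow> real"
  speed_eps :: "point \<Rightarrow> real"
  speed_x :: "nat \<Rightarrow> real"

abbreviation lo :: "element \<Rightarrow> point" where "lo \<equiv> fst"
abbreviation hi :: "element \<Rightarrow> point" where "hi \<equiv> snd"

definition width :: "element \<Rightarrow> nat \<Rightarrow> real" where
  "width K m = hi K m - lo K m"

definition cell :: "nat \<Rightarrow> element \<Rightarrow> point set" where
  "cell d K = (\<Pi>\<^sub>E m\<in>{0..d}. {lo K m<..<hi K m})"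

definition closed_cell :: "nat \<Rightarrow> element \<Rightarrow> point set" where
  "closed_cell d K = (\<Pi>\<^sub>E m\<in>{0..d}. {lo K m..hi K m})"

definition space_cell :: "nat \<Rightarrow> element \<Rightarrow> point set" where
  "space_cell d K = (\<Pi>\<^sub>E l\<in>{1..d}. {lo K l<..<hi K l})"

definition space_part :: "nat \<Rightarrow> point \<Rightarrow> point" where
  "space_part d z = restrict z {1..d}"

text \<open>\<open>K'\<close> lies directly above \<open>K\<close> in coordinate \<open>m\<close> and shares the whole common face.\<close>

definition above :: "nat \<Rightarrow> nat \<Rightarrow> element \<Rightarrow> element \<Rightarrow> bool" where
  "above d m K K' \<longleftrightarrow>
     lo K' m = hi K m \<and> (\<forall>m'\<in>{0..d} - {m}. lo K' m' = lo K m' \<and> hi K' m' = hi K m')"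

text \<open>Disjoint boxes without hanging faces: two elements whose faces overlap share the whole face.
  The lower end of an energy element may be \<open>0\<close>.\<close>

definition valid_mesh :: "nat \<Rightarrow> element set \<Rightarrow> bool" where
  "valid_mesh d T \<longleftrightarrow>
     finite T \<and>
     (\<forall>K\<in>T. 0 \<le> lo K 0 \<and> (\<forall>m\<in>{0..d}. lo K m < hi K m)) \<and>
     (\<forall>K\<in>T. \<forall>K'\<in>T. K \<noteq> K' \<longrightarrow> cell d K \<inter> cell d K' = {}) \<and>
     (\<forall>K\<in>T. \<forall>K'\<in>T. \<forall>m\<in>{0..d}.
        lo K' m = hi K m \<and>
        (\<forall>m'\<in>{0..d} - {m}. {lo K m'<..<hi K m'} \<inter> {lo K' m'<..<hi K' m'} \<noteq> {})
        \<longrightarrow> above d m K K')"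

definition eps_volume :: "element \<Rightarrow> real" where
  "eps_volume K = (LBINT \<epsilon>:{lo K 0<..<hi K 0}. \<epsilon>\<^sup>2)"

definition volume :: "nat \<Rightarrow> element \<Rightarrow> real" where
  "volume d K = eps_volume K * (\<Prod>l\<in>{1..d}. width K l)"

definition ref_to_cell :: "element \<Rightarrow> nat \<Rightarrow> real \<Rightarrow> real" where
  "ref_to_cell K m \<xi> = lo K m + (1 + \<xi>) / 2 * width K m"

definition tensor_points :: "nat \<Rightarrow> element \<Rightarrow> (nat \<Rightarrow> real set) \<Rightarrow> point set" where
  "tensor_points d K A =
     (\<lambda>\<xi>. \<lambda>m\<in>{0..d}. ref_to_cell K m (\<xi> m)) ` (\<Pi>\<^sub>E m\<in>{0..d}. A m)"

definition S_tensor :: "dg_scheme \<Rightarrow> element \<Rightarrow> point set" where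
  "S_tensor S K = tensor_points (space_dim S) K (\<lambda>_. lg_nodes (lg_num S))"

definition S_hat_eps :: "dg_scheme \<Rightarrow> element \<Rightarrow> point set" where
  "S_hat_eps S K =
     tensor_points (space_dim S) K ((\<lambda>_. lg_nodes (lg_num S))(0 := lgl_nodes (lgl_num_eps S)))"

definition S_hat_x :: "dg_scheme \<Rightarrow> nat \<Rightarrow> element \<Rightarrow> point set" where
  "S_hat_x S l K =
     tensor_points (space_dim S) K ((\<lambda>_. lg_nodes (lg_num S))(l := lgl_nodes (lgl_num_x S)))"

definition S_tilde :: "dg_scheme \<Rightarrow> element \<Rightarrow> point set" where
  "S_tilde S K = S_tensor S K \<union> S_hat_eps S K \<union> (\<Union>l\<in>{1..space_dim S}. S_hat_x S l K)"

text \<open>Tensor-product LG quadrature over the coordinates in \<open>J\<close>.\<close>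

definition lg_quad :: "dg_scheme \<Rightarrow> element \<Rightarrow> nat set \<Rightarrow> (point \<Rightarrow> state) \<Rightarrow> state" where
  "lg_quad S K J h =
     (\<Sum>\<xi>\<in>(\<Pi>\<^sub>E m\<in>J. lg_nodes (lg_num S)).
        (\<Prod>m\<in>J. width K m * lg_weight (lg_num S) (\<xi> m)) *\<^sub>R h (\<lambda>m\<in>J. ref_to_cell K m (\<xi> m)))"

definition tensor_polynomial :: "nat \<Rightarrow> nat \<Rightarrow> (point \<Rightarrow> state) \<Rightarrow> bool" where
  "tensor_polynomial d k h \<longleftrightarrow>
     (\<exists>c :: (nat \<Rightarrow> nat) \<Rightarrow> state.
        \<forall>z. h z = (\<Sum>\<alpha>\<in>(\<Pi>\<^sub>E m\<in>{0..d}. {..k}). (\<Prod>m\<in>{0..d}. z m ^ \<alpha> m) *\<^sub>R c \<alpha>))"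

definition cell_average :: "nat \<Rightarrow> field \<Rightarrow> element \<Rightarrow> state" where
  "cell_average d U K =
     (1 / volume d K) *\<^sub>R (LINT z:cell d K|PiM {0..d} (\<lambda>_. lborel). (z 0)\<^sup>2 *\<^sub>R U K z)"

text \<open>Exactness of LGL quadrature in one coordinate, the other coordinates being held fixed.\<close>

definition lgl_exact_x :: "dg_scheme \<Rightarrow> field \<Rightarrow> element \<Rightarrow> nat \<Rightarrow> bool" where
  "lgl_exact_x S U K l \<longleftrightarrow>
     (\<forall>z\<in>closed_cell (space_dim S) K.
        (1 / width K l) *\<^sub>R (LBINT t:{lo K l<..<hi K l}. U K (z(l := t))) =
        (\<Sum>\<xi>\<in>lgl_nodes (lgl_num_x S).
           lgl_weight (lgl_num_x S) \<xi> *\<^sub>R U K (z(l := ref_to_cell K l \<xi>))))"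

definition lgl_exact_eps :: "dg_scheme \<Rightarrow> field \<Rightarrow> element \<Rightarrow> bool" where
  "lgl_exact_eps S U K \<longleftrightarrow>
     (\<forall>z\<in>closed_cell (space_dim S) K.
        (1 / eps_volume K) *\<^sub>R (LBINT \<epsilon>:{lo K 0<..<hi K 0}. \<epsilon>\<^sup>2 *\<^sub>R U K (z(0 := \<epsilon>))) =
        (width K 0 / eps_volume K) *\<^sub>R
        (\<Sum>\<xi>\<in>lgl_nodes (lgl_num_eps S).
           (lgl_weight (lgl_num_eps S) \<xi> * (ref_to_cell K 0 \<xi>)\<^sup>2) *\<^sub>R
             U K (z(0 := ref_to_cell K 0 \<xi>))))"

section \<open>Closure and numerical fluxes\<close>

text \<open>\<open>closure_f S \<epsilon> x U\<close> is the density closing the moment value \<open>U\<close>; all fluxes are moments of it.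
  No integrable density closes a value with \<open>\<E> = |\<F>|\<close>, so exactness of the closure is a
  property of individual values and not of all of \<open>realizable\<close>.\<close>

definition exact_closure :: "dg_scheme \<Rightarrow> point \<Rightarrow> state \<Rightarrow> bool" where
  "exact_closure S z U \<longleftrightarrow>
     (let \<epsilon> = z 0; x = space_part (space_dim S) z; f = closure_f S \<epsilon> x U
      in f \<in> densities \<and> U = mom_U (vel S x) \<epsilon> f)"

definition flux_x :: "dg_scheme \<Rightarrow> nat \<Rightarrow> point \<Rightarrow> state \<Rightarrow> state" where
  "flux_x S l z U =
     (let \<epsilon> = z 0; x = space_part (space_dim S) z in mom_F (vel S x) \<epsilon> (closure_f S \<epsilon> x U) l)"

definition flux_eps :: "dg_scheme \<Rightarrow> point \<Rightarrow> state \<Rightarrow> state" where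
  "flux_eps S z U =
     (let \<epsilon> = z 0; x = space_part (space_dim S) z
      in mom_Feps (vel S x) (grad_u S x) \<epsilon> (closure_f S \<epsilon> x U))"

definition Utilde :: "dg_scheme \<Rightarrow> point \<Rightarrow> state \<Rightarrow> state" where
  "Utilde S z U =
     (let \<epsilon> = z 0; x = space_part (space_dim S) z in mom_Utilde (vel S x) \<epsilon> (closure_f S \<epsilon> x U))"

definition numflux_x :: "dg_scheme \<Rightarrow> nat \<Rightarrow> point \<Rightarrow> state \<Rightarrow> state \<Rightarrow> state" where
  "numflux_x S l z Um Up =
     (1/2) *\<^sub>R (flux_x S l z Um + flux_x S l z Up - speed_x S l *\<^sub>R (Up - Um))"

definition numflux_eps :: "dg_scheme \<Rightarrow> point \<Rightarrow> state \<Rightarrow> state \<Rightarrow> state" where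
  "numflux_eps S z Um Up =
     (1/2) *\<^sub>R (flux_eps S z Um + flux_eps S z Up
       - speed_eps S (space_part (space_dim S) z) *\<^sub>R (Utilde S z Up - Utilde S z Um))"

text \<open>Exterior traces on the upper and lower face of \<open>K\<close> in coordinate \<open>m\<close>; \<open>g\<close> is the boundary
  data. The neighbour across a face is unique in a valid mesh.\<close>

definition trace_above :: "dg_scheme \<Rightarrow> field \<Rightarrow> (point \<Rightarrow> state) \<Rightarrow> element \<Rightarrow> nat \<Rightarrow> point \<Rightarrow> state" where
  "trace_above S U g K m z =
     (if \<exists>K'\<in>mesh S. above (space_dim S) m K K'
      then U (SOME K'. K' \<in> mesh S \<and> above (space_dim S) m K K') z else g z)"

definition trace_below :: "dg_scheme \<Rightarrow> field \<Rightarrow> (point \<Rightarrow> state) \<Rightarrow> element \<Rightarrow> nat \<Rightarrow> point \<Rightarrow> state" where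
  "trace_below S U g K m z =
     (if \<exists>K'\<in>mesh S. above (space_dim S) m K' K
      then U (SOME K'. K' \<in> mesh S \<and> above (space_dim S) m K' K) z else g z)"

definition boundary_points :: "dg_scheme \<Rightarrow> point set" where
  "boundary_points S =
     {z. \<exists>K\<in>mesh S. z \<in> closed_cell (space_dim S) K \<and> (\<exists>m\<in>{0..space_dim S}.
        z m = hi K m \<and> \<not> (\<exists>K'\<in>mesh S. above (space_dim S) m K K') \<or>
        z m = lo K m \<and> \<not> (\<exists>K'\<in>mesh S. above (space_dim S) m K' K))}"

definition face_flux_eps_hi :: "dg_scheme \<Rightarrow> field \<Rightarrow> (point \<Rightarrow> state) \<Rightarrow> element \<Rightarrow> point \<Rightarrow> state" where
  "face_flux_eps_hi S U g K y =
     (let z = y(0 := hi K 0) in numflux_eps S z (U K z) (trace_above S U g K 0 z))"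

definition face_flux_eps_lo :: "dg_scheme \<Rightarrow> field \<Rightarrow> (point \<Rightarrow> state) \<Rightarrow> element \<Rightarrow> point \<Rightarrow> state" where
  "face_flux_eps_lo S U g K y =
     (let z = y(0 := lo K 0) in numflux_eps S z (trace_below S U g K 0 z) (U K z))"

definition face_flux_x_hi ::
    "dg_scheme \<Rightarrow> field \<Rightarrow> (point \<Rightarrow> state) \<Rightarrow> element \<Rightarrow> nat \<Rightarrow> point \<Rightarrow> state" where
  "face_flux_x_hi S U g K l y =
     (let z = y(l := hi K l) in numflux_x S l z (U K z) (trace_above S U g K l z))"

definition face_flux_x_lo ::
    "dg_scheme \<Rightarrow> field \<Rightarrow> (point \<Rightarrow> state) \<Rightarrow> element \<Rightarrow> nat \<Rightarrow> point \<Rightarrow> state" where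
  "face_flux_x_lo S U g K l y =
     (let z = y(l := lo K l) in numflux_x S l z (trace_below S U g K l z) (U K z))"

section \<open>Explicit update and time step\<close>

definition transport :: "dg_scheme \<Rightarrow> field \<Rightarrow> (point \<Rightarrow> state) \<Rightarrow> element \<Rightarrow> state" where
  "transport S U g K =
     - (1 / volume (space_dim S) K) *\<^sub>R
         lg_quad S K {1..space_dim S} (\<lambda>y. (hi K 0)^3 *\<^sub>R face_flux_eps_hi S U g K y
                                    - (lo K 0)^3 *\<^sub>R face_flux_eps_lo S U g K y)
     - (\<Sum>l\<in>{1..space_dim S}. (1 / volume (space_dim S) K) *\<^sub>R
         lg_quad S K ({0..space_dim S} - {l}) (\<lambda>y. (y 0)\<^sup>2 *\<^sub>R
           (face_flux_x_hi S U g K l y - face_flux_x_lo S U g K l y)))"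

definition substage ::
    "dg_scheme \<Rightarrow> (nat \<Rightarrow> nat \<Rightarrow> real) \<Rightarrow> real \<Rightarrow> (nat \<Rightarrow> field) \<Rightarrow> (nat \<Rightarrow> point \<Rightarrow> state)
      \<Rightarrow> nat \<Rightarrow> nat \<Rightarrow> element \<Rightarrow> state" where
  "substage S chat dt U g i j K =
     cell_average (space_dim S) (U j) K + (chat i j * dt) *\<^sub>R transport S (U j) (g j) K"

definition explicit_update ::
    "dg_scheme \<Rightarrow> (nat \<Rightarrow> nat \<Rightarrow> real) \<Rightarrow> (nat \<Rightarrow> nat \<Rightarrow> real) \<Rightarrow> real \<Rightarrow> (nat \<Rightarrow> field)
      \<Rightarrow> (nat \<Rightarrow> point \<Rightarrow> state) \<Rightarrow> nat \<Rightarrow> element \<Rightarrow> state" where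
  "explicit_update S c chat dt U g i K = (\<Sum>j<i. c i j *\<^sub>R substage S chat dt U g i j K)"

text \<open>Extended reals, so that the quotients are \<open>\<infinity>\<close> when \<open>chat i j = 0\<close> or
  \<open>speed_eps S x = 0\<close>.\<close>

definition ssp_factor :: "nat \<Rightarrow> (nat \<Rightarrow> nat \<Rightarrow> real) \<Rightarrow> ereal" where
  "ssp_factor s chat = Min {1 / ereal (chat i j) | i j. 1 \<le> i \<and> i \<le> s \<and> j < i}"

definition cfl_bound :: "dg_scheme \<Rightarrow> ereal" where
  "cfl_bound S = (INF K\<in>mesh S. min
     (INF x\<in>space_cell (space_dim S) K.
        ereal (lorentz (vel S x) * (1 - norm (vel S x))
               * (lgl_weight (lgl_num_eps S) 1 * width K 0))
        / ereal ((real (space_dim S) + 1) * hi K 0 * speed_eps S x))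
     (INF l\<in>{1..space_dim S}.
        ereal (lgl_weight (lgl_num_x S) 1 * width K l)
        / ereal ((real (space_dim S) + 1) * speed_x S l)))"

end

theory Submission
  imports Defs
begin

text \<open>The closed cone \<open>\<E> \<ge> |\<F>|\<close> contains every angular mean of a nonnegative weight against
  \<open>(1, L\<^sub>j)\<close>, because \<open>L\<close> is a unit vector. The cell average is split into \<open>d + 1\<close> equal shares, one
  for each phase-space coordinate; in the share of a coordinate LGL nodes are used in that coordinate
  and LG nodes in all others, so that the two face values line up with the numerical fluxes. Each
  Lax--Friedrichs flux then breaks up into terms \<open>a U \<plusminus> F\<close>, whose weights \<open>a \<plusminus> L\<^sup>l\<close> and
  \<open>a \<plusminus> q\<close> are nonnegative, and the remaining multiple of the face value is nonnegative by the
  time-step restriction (with \<open>E / \<epsilon> \<ge> W (1 - v)\<close> in the energy direction). Strict positivity of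
  the energy comes from the spatial faces: \<open>{\<omega>. L\<^sup>l = \<plusminus>1}\<close> is a null set.\<close>

section \<open>Legendre polynomials and quadrature weights\<close>

text \<open>Two losses of strictness shape the proof. The time-step bound may hold with equality, so
  the leftover multiple of a face value can be 0; and for \<open>polydeg S\<close> \<le> 1 two LGL
  nodes are allowed in space, so a spatial share need not have interior nodes. What then remains are
  a U + F and a U - F with a = 1 permitted. Their weights do vanish at some directions, but
  multiplied by E they are affine in the rest-frame direction with a nonzero constant term, so the
  exceptional set is null. The energy direction has no such margin, because q and
  \<open>speed_eps\<close> may vanish together.

  The energy flux dissipates Utilde while the cell average consists of U; comparing their weights E
  and E^2 / \<epsilon> is what makes the energy bound depend on the velocity. The flux carries
  \<epsilon>^3 against \<epsilon>^2 in the average, which brings in the upper cell energy. The same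
  \<epsilon>^2 is the reason for LG exactness up to degree \<open>polydeg S + 2\<close>.

  Location of roots and signs of weights come from the three-term recurrence; the unit sum of the LG
  weights comes from exactness.\<close>

lemma legendre_ge_1_mono:
  assumes "1 \<le> x"
  shows "1 \<le> poly (legendre n) x \<and> poly (legendre n) x \<le> poly (legendre (Suc n)) x"
proof (induction n)
  case 0
  then show ?case using assms by simp
next
  case (Suc n)
  define a where "a = poly (legendre n) x"
  define b where "b = poly (legendre (Suc n)) x"
  have ab: "1 \<le> a" "a \<le> b" using Suc by (auto simp: a_def b_def)
  have "(real n + 2) * poly (legendre (Suc (Suc n))) x = (2 * real n + 3) * (x * b) - (real n + 1) * a"
    by (simp add: a_def b_def field_simps)
  \<comment> \<open>Since \<open>a\<close> \<le> \<open>b\<close> \<le> \<open>x * b\<close>, the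
    recurrence loses at most (n + 1) \<open>b\<close> from (2 n + 3) \<open>b\<close>, which leaves
    exactly (n + 2) \<open>b\<close>.\<close>
  moreover have "(2 * real n + 3) * b \<le> (2 * real n + 3) * (x * b)"
    using ab assms mult_right_mono[of 1 x b] by (intro mult_left_mono) auto
  moreover have "(real n + 1) * a \<le> (real n + 1) * b"
    using ab by (intro mult_left_mono) auto
  ultimately have "(real n + 2) * b \<le> (real n + 2) * poly (legendre (Suc (Suc n))) x"
    by (simp add: algebra_simps del: legendre.simps)
  then have "b \<le> poly (legendre (Suc (Suc n))) x"
    by (rule mult_left_le_imp_le) simp
  then show ?case using ab by (simp add: b_def del: legendre.simps)
qed

lemma legendre_at_1: "poly (legendre n) 1 = 1"
  by (induction n rule: legendre.induct) (auto simp: field_simps)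

lemma legendre_minus: "poly (legendre n) (- x) = (-1) ^ n * poly (legendre n) x"
  by (induction n rule: legendre.induct) (simp_all add: algebra_simps)

text \<open>Values of at least 1 beyond 1, and parity for the other side, confine the roots to the
  open interval. Hence LG points lie strictly inside each cell and 1 - x^2 in
  \<open>lg_weight\<close> is positive.\<close>

lemma legendre_root_bounds:
  assumes "poly (legendre n) x = 0"
  shows "- 1 < x" "x < 1"
proof -
  show "x < 1"
    using assms legendre_ge_1_mono[of x n] by (cases "1 \<le> x") auto
  show "- 1 < x"
    using assms legendre_ge_1_mono[of "- x" n] by (cases "1 \<le> - x") (auto simp: legendre_minus)
qed

lemma legendre_nonzero: "legendre n \<noteq> 0"
  using legendre_at_1[of n] by auto

text \<open>A constant would keep the value 1 that P_n takes at 1, but monotonicity in n lifts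
  P_n(2) to at least P_1(2) = 2. A nonzero derivative makes the interior LGL nodes finitely many; a
  sum over an infinite set would silently be 0.\<close>

lemma pderiv_legendre_nonzero:
  assumes "0 < n"
  shows "pderiv (legendre n) \<noteq> 0"
proof
  assume "pderiv (legendre n) = 0"
  then have "degree (legendre n) = 0" by (simp add: pderiv_eq_0_iff)
  then obtain a where "legendre n = [:a:]" by (rule degree_eq_zeroE)
  then have "poly (legendre n) 2 = 1" using legendre_at_1[of n] by simp
  moreover have "2 \<le> poly (legendre n) 2" using assms
  proof (induction n rule: nat_induct_non_zero)
    case (Suc n)
    then show ?case using legendre_ge_1_mono[of 2 n] by simp
  qed simp
  ultimately show False by simp
qed

lemma finite_lg_nodes [simp]: "finite (lg_nodes N)"
  unfolding lg_nodes_def by (rule poly_roots_finite[OF legendre_nonzero])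

lemma lg_nodes_bounds:
  assumes "\<xi> \<in> lg_nodes N"
  shows "- 1 < \<xi>" "\<xi> < 1"
  using assms legendre_root_bounds by (auto simp: lg_nodes_def)

lemma lg_weight_nonneg:
  assumes "\<xi> \<in> lg_nodes N"
  shows "0 \<le> lg_weight N \<xi>"
proof -
  have "\<xi>\<^sup>2 < 1" using lg_nodes_bounds[OF assms] by (simp add: abs_square_less_1)
  \<comment> \<open>This covers a multiple root too: there the weight is 1 / 0 = 0 by
    convention.\<close>
  then show ?thesis by (simp add: lg_weight_def)
qed

lemma finite_lgl_nodes [simp]:
  assumes "2 \<le> M"
  shows "finite (lgl_nodes M)"
  using assms poly_roots_finite[OF pderiv_legendre_nonzero[of "M - 1"]]
  by (simp add: lgl_nodes_def)

lemma lgl_weight_nonneg: "1 \<le> M \<Longrightarrow> 0 \<le> lgl_weight M \<xi>"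
  by (simp add: lgl_weight_def)

lemma lgl_weight_1_pos: "2 \<le> M \<Longrightarrow> 0 < lgl_weight M 1"
  by (simp add: lgl_weight_def legendre_at_1)

text \<open>Parity gives both end nodes the same weight, so one constant in the time step serves the
  upper and the lower face.\<close>

lemma lgl_weight_minus: "lgl_weight M (- \<xi>) = lgl_weight M \<xi>"
  by (simp add: lgl_weight_def legendre_minus power_mult_distrib power_mult[symmetric])

text \<open>Exactness on the constant 1. It also certifies that some weight is positive, on which
  the positivity of cell volumes and of quadrature sums rests.\<close>

lemma sum_lg_weight:
  assumes "lg_exact N n"
  shows "(\<Sum>\<xi>\<in>lg_nodes N. lg_weight N \<xi>) = 1"
proof -
  have "(1/2) * (LBINT x:{-1..1}. poly 1 x) = (\<Sum>\<xi>\<in>lg_nodes N. lg_weight N \<xi> * poly 1 \<xi>)"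
    using assms unfolding lg_exact_def by (metis degree_1 zero_le)
  then show ?thesis by (simp add: set_lebesgue_integral_def)
qed

lemma lg_exact_cell:
  assumes "lg_exact N k" "n \<le> k" "lo K m < hi K m"
  shows "(LBINT t:{lo K m<..<hi K m}. t ^ n)
    = (\<Sum>\<xi>\<in>lg_nodes N. width K m * lg_weight N \<xi> * ref_to_cell K m \<xi> ^ n)"
proof -
  define w where "w = width K m"
  have w: "0 < w" using assms by (simp add: w_def width_def)
  have hi: "hi K m = lo K m + w" by (simp add: w_def width_def)
  \<comment> \<open>The monomial t^n pulled back to the reference interval; its degree is still at
    most \<open>n\<close>.\<close>
  define p where "p = [:lo K m + w / 2, w / 2:] ^ n"
  have ev: "poly p x = ref_to_cell K m x ^ n" for x
    by (simp add: p_def ref_to_cell_def w_def field_simps)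
  have "degree p \<le> degree [:lo K m + w / 2, w / 2:] * n"
    unfolding p_def by (rule degree_power_le)
  also have "\<dots> \<le> 1 * k"
    by (intro mult_mono) (use assms in auto)
  finally have ex: "(1/2) * (LBINT x:{-1..1}. poly p x) = (\<Sum>x\<in>lg_nodes N. lg_weight N x * poly p x)"
    using assms(1) by (simp add: lg_exact_def)
  have "(LBINT t:{lo K m<..<hi K m}. t ^ n)
    = \<bar>w / 2\<bar> *\<^sub>R (LBINT x. indicator {lo K m<..<hi K m} (lo K m + w / 2 + w / 2 * x)
         *\<^sub>R (lo K m + w / 2 + w / 2 * x) ^ n)"
    unfolding set_lebesgue_integral_def
    by (rule lborel_integral_real_affine) (use w in simp)
  also have "(LBINT x. indicator {lo K m<..<hi K m} (lo K m + w / 2 + w / 2 * x)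
         *\<^sub>R (lo K m + w / 2 + w / 2 * x) ^ n) = (LBINT x:{-1..1}. poly p x)"
    unfolding set_lebesgue_integral_def
  proof (rule integral_cong_AE)
    have "AE x in lborel. x \<noteq> (1::real)" "AE x in lborel. x \<noteq> (-1::real)"
      by (rule AE_lborel_singleton)+
    then show "AE x in lborel. indicator {lo K m<..<hi K m} (lo K m + w / 2 + w / 2 * x)
         *\<^sub>R (lo K m + w / 2 + w / 2 * x) ^ n = indicator {-1..1} x *\<^sub>R poly p x"
    proof eventually_elim
      case (elim x)
      have "lo K m < lo K m + w / 2 + w / 2 * x \<longleftrightarrow> 0 < w * (1 + x)" by (simp add: field_simps)
      moreover have "lo K m + w / 2 + w / 2 * x < hi K m \<longleftrightarrow> 0 < w * (1 - x)"
        by (simp add: field_simps hi)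
      ultimately have "indicator {lo K m<..<hi K m} (lo K m + w / 2 + w / 2 * x)
          = (indicator {-1..1} x :: real)"
        using elim w by (auto simp: indicator_def zero_less_mult_iff)
      then show ?case by (simp add: p_def algebra_simps)
    qed
  qed (auto simp: p_def)
  also have "\<bar>w / 2\<bar> *\<^sub>R (LBINT x:{-1..1}. poly p x)
      = w * ((1/2) * (LBINT x:{-1..1}. poly p x))"
    using w by simp
  also have "\<dots> = (\<Sum>\<xi>\<in>lg_nodes N. w * lg_weight N \<xi> * ref_to_cell K m \<xi> ^ n)"
    unfolding ex by (simp add: sum_distrib_left ev mult.assoc)
  finally show ?thesis by (simp add: w_def)
qed

section \<open>The realizable cone\<close>

text \<open>Realizability without strictness: it contains 0 and is closed under nonnegative
  combinations, so contributions that may vanish can be collected here.\<close>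

definition light_cone :: "state set" where
  "light_cone = {(e, F). norm F \<le> e}"

lemma light_cone_iff: "U \<in> light_cone \<longleftrightarrow> norm (snd U) \<le> fst U"
  by (simp add: light_cone_def case_prod_unfold)

lemma realizable_iff: "U \<in> realizable \<longleftrightarrow> 0 < fst U \<and> U \<in> light_cone"
  by (simp add: realizable_def case_prod_unfold light_cone_iff norm_eq_sqrt_inner)

lemma light_cone_0 [simp]: "0 \<in> light_cone"
  by (simp add: light_cone_iff)

lemma light_cone_fst_nonneg: "U \<in> light_cone \<Longrightarrow> 0 \<le> fst U"
  unfolding light_cone_iff using norm_ge_zero order_trans by blast

lemma light_cone_add: "U \<in> light_cone \<Longrightarrow> V \<in> light_cone \<Longrightarrow> U + V \<in> light_cone"
  unfolding light_cone_iff using norm_triangle_mono by fastforce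

lemma light_cone_scaleR: "U \<in> light_cone \<Longrightarrow> 0 \<le> c \<Longrightarrow> c *\<^sub>R U \<in> light_cone"
  unfolding light_cone_iff by (simp add: mult_left_mono)

lemma light_cone_sum: "(\<And>x. x \<in> A \<Longrightarrow> h x \<in> light_cone) \<Longrightarrow> sum h A \<in> light_cone"
  by (induction A rule: infinite_finite_induct) (auto intro: light_cone_add)

lemma realizable_light_cone: "U \<in> realizable \<Longrightarrow> U \<in> light_cone"
  by (simp add: realizable_iff)

text \<open>One summand of positive energy is enough for the whole sum; strictness is passed through
  sums by this rule, with the strict term on the left.\<close>

lemma realizable_add: "U \<in> realizable \<Longrightarrow> V \<in> light_cone \<Longrightarrow> U + V \<in> realizable"
  using light_cone_add[of U V] light_cone_fst_nonneg[of V] by (auto simp: realizable_iff)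

lemma realizable_scaleR: "U \<in> realizable \<Longrightarrow> 0 < c \<Longrightarrow> c *\<^sub>R U \<in> realizable"
  by (simp add: realizable_iff light_cone_scaleR)

lemma realizable_weighted_sum:
  assumes "finite A" "\<And>x. x \<in> A \<Longrightarrow> 0 \<le> w x" "sum w A > 0"
    and "\<And>x. x \<in> A \<Longrightarrow> h x \<in> realizable"
  shows "(\<Sum>x\<in>A. w x *\<^sub>R h x) \<in> realizable"
proof -
  obtain a where a: "a \<in> A" "0 < w a"
    using assms(3) by (meson linorder_not_less sum_nonpos)
  have "w a *\<^sub>R h a + (\<Sum>x\<in>A - {a}. w x *\<^sub>R h x) \<in> realizable"
    using a assms(2,4)
    by (intro realizable_add realizable_scaleR light_cone_sum light_cone_scaleR)
       (auto intro: realizable_light_cone)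
  then show ?thesis by (simp add: sum.remove[OF assms(1) a(1)])
qed

section \<open>Kinematics\<close>

lemma unit_dir_eq:
  "unit_dir \<omega> = cos (fst \<omega>) *\<^sub>R axis 1 1 + (sin (fst \<omega>) * cos (snd \<omega>)) *\<^sub>R axis 2 1
     + (sin (fst \<omega>) * sin (snd \<omega>)) *\<^sub>R axis 3 1"
  by (simp add: unit_dir_def case_prod_unfold vec_eq_iff forall_3 vector_3 axis_def)

lemma norm_unit_dir: "norm (unit_dir \<omega>) = 1"
proof -
  have "(cos a)\<^sup>2 + ((sin a * cos b)\<^sup>2 + (sin a * sin b)\<^sup>2) = 1" for a b :: real
  proof -
    have "(sin a * cos b)\<^sup>2 + (sin a * sin b)\<^sup>2 = (sin a)\<^sup>2 * ((sin b)\<^sup>2 + (cos b)\<^sup>2)"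
      by (simp add: power_mult_distrib algebra_simps del: sin_cos_squared_add sin_cos_squared_add2)
    then show ?thesis by simp
  qed
  then have "unit_dir \<omega> \<bullet> unit_dir \<omega> = 1"
    by (simp add: unit_dir_def case_prod_unfold inner_vec_def sum_3 vector_3
        power2_eq_square[symmetric] add.assoc)
  then show ?thesis by (simp add: norm_eq_sqrt_inner)
qed

lemma lorentz_pos: "norm v < 1 \<Longrightarrow> 0 < lorentz v"
  by (simp add: lorentz_def abs_square_less_1)

lemma lorentz_square: "norm v < 1 \<Longrightarrow> (lorentz v)\<^sup>2 * (1 - (norm v)\<^sup>2) = 1"
proof -
  assume "norm v < 1"
  then have "0 < 1 - (norm v)\<^sup>2" by (simp add: abs_square_less_1)
  then show ?thesis by (simp add: lorentz_def power_divide)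
qed

text \<open>For \<open>v = 0\<close> the value is \<open>0\<close>, so that the boost needs no case distinction.\<close>

definition boost_coeff :: "real^3 \<Rightarrow> real" where
  "boost_coeff v = (lorentz v - 1) / (norm v)\<^sup>2"

lemma energy_eq: "energy v \<epsilon> \<omega> = \<epsilon> * (lorentz v * (1 + v \<bullet> unit_dir \<omega>))"
  by (simp add: energy_def mink_def nvec_def momentum_def fourvel_def boosted_dir_def algebra_simps)

lemma fst_momentum: "fst (momentum v \<epsilon> \<omega>) = energy v \<epsilon> \<omega>"
  by (simp add: energy_def mink_def nvec_def)

lemma snd_momentum:
  "snd (momentum v \<epsilon> \<omega>) = \<epsilon> *\<^sub>R (lorentz v *\<^sub>R v + unit_dir \<omega>
     + (boost_coeff v * (v \<bullet> unit_dir \<omega>)) *\<^sub>R v)"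
  by (simp add: momentum_def fourvel_def boosted_dir_def boost_coeff_def algebra_simps)

lemma energy_lower_bound:
  assumes "norm v < 1" "0 < \<epsilon>"
  shows "\<epsilon> * (lorentz v * (1 - norm v)) \<le> energy v \<epsilon> \<omega>"
proof -
  have "\<bar>v \<bullet> unit_dir \<omega>\<bar> \<le> norm v"
    using Cauchy_Schwarz_ineq2[of v "unit_dir \<omega>"] by (simp add: norm_unit_dir)
  then show ?thesis
    unfolding energy_eq using assms lorentz_pos[OF assms(1)] by (intro mult_left_mono) auto
qed

lemma energy_pos:
  assumes "norm v < 1" "0 < \<epsilon>"
  shows "0 < energy v \<epsilon> \<omega>"
proof -
  have "0 < \<epsilon> * (lorentz v * (1 - norm v))" using assms lorentz_pos by simp
  then show ?thesis using energy_lower_bound[OF assms] by (rule less_le_trans)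
qed

text \<open>This says that p is null: u is unit timelike and the boosted direction is a unit vector
  orthogonal to it. In components everything rests on two scalar relations, \<open>kn\<close> for
  the boost and \<open>Wn\<close> for W^2 (1 - v^2) = 1.\<close>

lemma norm_snd_momentum:
  assumes "norm v < 1" "0 < \<epsilon>"
  shows "norm (snd (momentum v \<epsilon> \<omega>)) = energy v \<epsilon> \<omega>"
proof -
  define W where "W = lorentz v"
  define s where "s = v \<bullet> unit_dir \<omega>"
  define k where "k = boost_coeff v"
  define n where "n = v \<bullet> v"
  have uu: "unit_dir \<omega> \<bullet> unit_dir \<omega> = 1"
    using norm_unit_dir[of \<omega>] by (simp add: norm_eq_sqrt_inner)
  have us: "unit_dir \<omega> \<bullet> v = s" "v \<bullet> unit_dir \<omega> = s" "v \<bullet> v = n"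
    by (simp_all add: s_def n_def inner_commute)
  have kn: "k * n = W - 1"
  proof (cases "v = 0")
    case True
    then show ?thesis by (simp add: k_def n_def W_def lorentz_def)
  next
    case False
    then show ?thesis by (simp add: k_def boost_coeff_def n_def W_def power2_norm_eq_inner)
  qed
  have "W\<^sup>2 * (1 - n) = 1"
    using lorentz_square[OF assms(1)] by (simp add: W_def n_def power2_norm_eq_inner)
  then have Wn: "W * (W * n) = W * W - 1" by algebra
  have "(W *\<^sub>R v + unit_dir \<omega> + (k * s) *\<^sub>R v) \<bullet> (W *\<^sub>R v + unit_dir \<omega> + (k * s) *\<^sub>R v)
      = W * (W * n) + 1 + 2 * W * s + 2 * W * s * (k * n) + 2 * s * s * k + s * s * k * (k * n)"
    by (simp add: inner_add_left inner_add_right uu us algebra_simps)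
  also have "\<dots> = W * W + 2 * W * W * s + s * s * (k * (W + 1))"
    by (simp add: Wn kn algebra_simps)
  \<comment> \<open>After multiplication by \<open>n\<close> the factor \<open>k * (W + 1)\<close>
    is (W - 1)(W + 1) = W^2 - 1 = W^2 n, so \<open>n\<close> can be cancelled; for
    \<open>n = 0\<close> the velocity and hence \<open>s\<close> are zero.\<close>
  also have "s * s * (k * (W + 1)) = W * W * s * s"
  proof (cases "n = 0")
    case True
    then show ?thesis by (simp add: n_def s_def)
  next
    case False
    have "n * (k * (W + 1)) = n * (W * W)"
      using kn Wn by algebra
    then show ?thesis using False by simp
  qed
  also have "W * W + 2 * W * W * s + W * W * s * s = (W * (1 + s))\<^sup>2"
    by (simp add: power2_eq_square algebra_simps)
  finally have "(norm (snd (momentum v \<epsilon> \<omega>)))\<^sup>2 = (energy v \<epsilon> \<omega>)\<^sup>2"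
    by (simp add: snd_momentum energy_eq W_def s_def k_def power_mult_distrib
        power2_norm_eq_inner flip: power2_eq_square)
  then show ?thesis using energy_pos[OF assms, of \<omega>] by (simp add: power2_eq_iff_nonneg)
qed

lemma snd_Ldir: "snd (Ldir v \<epsilon> \<omega>) = (1 / energy v \<epsilon> \<omega>) *\<^sub>R snd (momentum v \<epsilon> \<omega>)"
  by (simp add: Ldir_def nvec_def)

lemma norm_snd_Ldir:
  assumes "norm v < 1" "0 < \<epsilon>"
  shows "norm (snd (Ldir v \<epsilon> \<omega>)) = 1"
  using energy_pos[OF assms, of \<omega>] by (simp add: snd_Ldir norm_snd_momentum[OF assms])

section \<open>Angular means\<close>

text \<open>About f only integrability is known, so moments are controlled only against bounded
  measurable weights. Sums and products stay in the class, which covers every weight built from E, L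
  and q.\<close>

definition bounded_weight :: "(real \<times> real \<Rightarrow> real) \<Rightarrow> bool" where
  "bounded_weight h \<longleftrightarrow> h \<in> borel_measurable borel \<and> (\<exists>B. \<forall>\<omega>. \<bar>h \<omega>\<bar> \<le> B)"

lemma bounded_weight_const: "bounded_weight (\<lambda>_. a)"
  by (auto simp: bounded_weight_def)

lemma bounded_weight_add:
  assumes "bounded_weight h1" "bounded_weight h2"
  shows "bounded_weight (\<lambda>\<omega>. h1 \<omega> + h2 \<omega>)"
proof -
  obtain A B where "\<And>\<omega>. \<bar>h1 \<omega>\<bar> \<le> A" "\<And>\<omega>. \<bar>h2 \<omega>\<bar> \<le> B"
    using assms by (auto simp: bounded_weight_def)
  then have "\<bar>h1 \<omega> + h2 \<omega>\<bar> \<le> A + B" for \<omega>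
    using abs_triangle_ineq add_mono order_trans by metis
  then show ?thesis using assms by (auto simp: bounded_weight_def)
qed

lemma bounded_weight_mult:
  assumes "bounded_weight h1" "bounded_weight h2"
  shows "bounded_weight (\<lambda>\<omega>. h1 \<omega> * h2 \<omega>)"
proof -
  obtain A B where AB: "\<And>\<omega>. \<bar>h1 \<omega>\<bar> \<le> A" "\<And>\<omega>. \<bar>h2 \<omega>\<bar> \<le> B"
    using assms by (auto simp: bounded_weight_def)
  have "\<bar>h1 \<omega> * h2 \<omega>\<bar> \<le> A * B" for \<omega>
    unfolding abs_mult using AB abs_ge_zero order_trans by (intro mult_mono) blast+
  then show ?thesis using assms by (auto simp: bounded_weight_def)
qed

lemma bounded_weight_sum:
  assumes "\<And>x. x \<in> A \<Longrightarrow> bounded_weight (h x)"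
  shows "bounded_weight (\<lambda>\<omega>. \<Sum>x\<in>A. h x \<omega>)"
  using assms
  by (induction A rule: infinite_finite_induct)
     (auto intro: bounded_weight_add bounded_weight_const)

lemmas bounded_weight_intros =
  bounded_weight_const bounded_weight_add bounded_weight_mult bounded_weight_sum

lemma borel_measurable_unit_dir [measurable]: "unit_dir \<in> borel_measurable borel"
proof -
  have "unit_dir = (\<lambda>\<omega>. cos (fst \<omega>) *\<^sub>R axis 1 1 + (sin (fst \<omega>) * cos (snd \<omega>)) *\<^sub>R axis 2 1
     + (sin (fst \<omega>) * sin (snd \<omega>)) *\<^sub>R axis 3 1)"
    using unit_dir_eq by blast
  moreover have "continuous_on UNIV (\<lambda>\<omega>::real \<times> real. cos (fst \<omega>) *\<^sub>R (axis 1 1 :: real^3)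
      + (sin (fst \<omega>) * cos (snd \<omega>)) *\<^sub>R axis 2 1
     + (sin (fst \<omega>) * sin (snd \<omega>)) *\<^sub>R axis 3 1)"
    by (intro continuous_intros)
  ultimately show ?thesis using borel_measurable_continuous_onI by metis
qed

lemma bounded_weight_unit_dir: "bounded_weight (\<lambda>\<omega>. b \<bullet> unit_dir \<omega>)"
proof -
  have "\<bar>b \<bullet> unit_dir \<omega>\<bar> \<le> norm b" for \<omega>
    using Cauchy_Schwarz_ineq2[of b "unit_dir \<omega>"] by (simp add: norm_unit_dir)
  then show ?thesis unfolding bounded_weight_def by auto
qed

lemma bounded_weight_energy: "bounded_weight (energy v \<epsilon>)"
proof -
  have "energy v \<epsilon> = (\<lambda>\<omega>. \<epsilon> * (lorentz v * (1 + v \<bullet> unit_dir \<omega>)))"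
    by (simp add: energy_eq fun_eq_iff)
  then show ?thesis by (simp only:) (intro bounded_weight_intros bounded_weight_unit_dir)
qed

lemma bounded_weight_momentum: "bounded_weight (\<lambda>\<omega>. comp (momentum v \<epsilon> \<omega>) \<mu>)"
proof (cases "\<mu> = 0")
  case True
  then show ?thesis by (simp add: comp_def fst_momentum bounded_weight_energy)
next
  case False
  have "unit_dir \<omega> $ j = axis j 1 \<bullet> unit_dir \<omega>" for j \<omega>
    by (simp add: inner_axis')
  then show ?thesis using False
    by (simp add: comp_def snd_momentum)
       (intro bounded_weight_intros bounded_weight_unit_dir)
qed

lemma bounded_weight_qfun: "bounded_weight (qfun v G \<epsilon>)"
proof -
  have "qfun v G \<epsilon> = (\<lambda>\<omega>. (1 / \<epsilon>\<^sup>2) * (\<Sum>\<nu>\<le>3. \<Sum>\<rho>\<le>3.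
      comp (momentum v \<epsilon> \<omega>) \<nu> * comp (momentum v \<epsilon> \<omega>) \<rho> * G \<nu> \<rho>))"
    by (auto simp: qfun_def)
  then show ?thesis by (simp only:) (intro bounded_weight_intros bounded_weight_momentum)
qed

lemma borel_measurable_Ldir [measurable]: "(\<lambda>\<omega>. snd (Ldir v \<epsilon> \<omega>)) \<in> borel_measurable borel"
  unfolding snd_Ldir snd_momentum energy_eq by measurable

lemma bounded_weight_Ldir:
  assumes "norm v < 1" "0 < \<epsilon>" "0 < i"
  shows "bounded_weight (\<lambda>\<omega>. comp (Ldir v \<epsilon> \<omega>) i)"
proof -
  have "\<bar>comp (Ldir v \<epsilon> \<omega>) i\<bar> \<le> 1" for \<omega>
    using assms component_le_norm_cart[of "snd (Ldir v \<epsilon> \<omega>)" "of_nat i"]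
    by (simp add: comp_def norm_snd_Ldir)
  moreover have "(\<lambda>\<omega>. axis (of_nat i) 1 \<bullet> snd (Ldir v \<epsilon> \<omega>)) \<in> borel_measurable borel"
    by measurable
  ultimately show ?thesis using assms unfolding bounded_weight_def
    by (auto simp: comp_def inner_axis')
qed

section \<open>Null sets and moments with respect to the sphere measure\<close>

lemma sets_sphere_measure [measurable_cong]: "sets sphere_measure = sets borel"
  by (simp add: sphere_measure_def)

lemma angles_borel [measurable]: "angles \<in> sets borel"
  unfolding angles_def by (metis borel_prod atLeastAtMost_borel atLeastLessThan_borel pair_measureI)

text \<open>The sphere measure has a Lebesgue density that is 0 outside \<open>angles\<close>, so
  null sets of directions can be found in the coordinates.\<close>

lemma AE_sphere_measure:
  assumes "AE \<omega> in lborel. \<omega> \<in> angles \<longrightarrow> P \<omega>"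
  shows "AE \<omega> in sphere_measure. P \<omega>"
proof -
  have "(\<lambda>\<omega>::real \<times> real. sin (fst \<omega>)) \<in> borel_measurable borel"
    by (intro borel_measurable_continuous_onI continuous_intros)
  then have "(\<lambda>\<omega>. ennreal (indicator angles \<omega> * sin (fst \<omega>))) \<in> borel_measurable lborel"
    by measurable
  then show ?thesis unfolding sphere_measure_def
    using assms by (subst AE_density) (auto elim!: eventually_mono split: split_indicator_asm)
qed

text \<open>Up to sign all moments in use have this form and differ only in the scalar weight
  \<open>h\<close>. A linear combination of moments thus becomes a question about the sign of one
  combined weight.\<close>

definition angular_mean ::
    "real^3 \<Rightarrow> real \<Rightarrow> (real \<times> real \<Rightarrow> real) \<Rightarrow> (real \<times> real \<Rightarrow> real) \<Rightarrow> state" where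
  "angular_mean v \<epsilon> f h = sphere_mean (\<lambda>\<omega>. (h \<omega> * f \<omega>) *\<^sub>R oneL v \<epsilon> \<omega>)"

context
  fixes v :: "real^3" and \<epsilon> :: real and f :: "real \<times> real \<Rightarrow> real"
  assumes v: "norm v < 1" and \<epsilon>: "0 < \<epsilon>" and f: "f \<in> densities"
begin

lemma integrable_weight_density:
  assumes "bounded_weight h"
  shows "integrable sphere_measure (\<lambda>\<omega>. h \<omega> * f \<omega>)"
proof -
  obtain B where B: "\<And>\<omega>. \<bar>h \<omega>\<bar> \<le> B" and [measurable]: "h \<in> borel_measurable borel"
    using assms by (auto simp: bounded_weight_def)
  have f': "integrable sphere_measure f" using f by (simp add: densities_def)
  then have [measurable]: "f \<in> borel_measurable borel"
    using borel_measurable_integrable measurable_cong_sets sets_sphere_measure by blast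
  show ?thesis
  proof (rule Bochner_Integration.integrable_bound)
    show "integrable sphere_measure (\<lambda>\<omega>. B * f \<omega>)" using f' by simp
    have "\<bar>h \<omega>\<bar> \<le> \<bar>B\<bar>" for \<omega> using B[of \<omega>] by linarith
    then show "AE \<omega> in sphere_measure. norm (h \<omega> * f \<omega>) \<le> norm (B * f \<omega>)"
      by (simp add: abs_mult mult_right_mono)
  qed measurable
qed

lemma integrable_weight_oneL:
  assumes "bounded_weight h"
  shows "integrable sphere_measure (\<lambda>\<omega>. (h \<omega> * f \<omega>) *\<^sub>R oneL v \<epsilon> \<omega>)"
proof (rule Bochner_Integration.integrable_bound)
  have *: "integrable sphere_measure (\<lambda>\<omega>. h \<omega> * f \<omega>)"
    by (rule integrable_weight_density[OF assms])
  then show "integrable sphere_measure (\<lambda>\<omega>. 2 * (h \<omega> * f \<omega>))" by simp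
  have [measurable]: "(\<lambda>\<omega>. h \<omega> * f \<omega>) \<in> borel_measurable borel"
    using borel_measurable_integrable[OF *] measurable_cong_sets sets_sphere_measure by blast
  show "(\<lambda>\<omega>. (h \<omega> * f \<omega>) *\<^sub>R oneL v \<epsilon> \<omega>) \<in> borel_measurable sphere_measure"
    unfolding oneL_def by measurable
  have "norm (oneL v \<epsilon> \<omega>) \<le> 2" for \<omega>
    using norm_Pair_le[of "1::real" "snd (Ldir v \<epsilon> \<omega>)"] by (simp add: oneL_def norm_snd_Ldir[OF v \<epsilon>])
  then have "\<bar>h \<omega> * f \<omega>\<bar> * norm (oneL v \<epsilon> \<omega>) \<le> \<bar>h \<omega> * f \<omega>\<bar> * 2" for \<omega>
    by (rule mult_left_mono) simp
  then show "AE \<omega> in sphere_measure. norm ((h \<omega> * f \<omega>) *\<^sub>R oneL v \<epsilon> \<omega>) \<le> norm (2 * (h \<omega> * f \<omega>))"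
    by (simp add: abs_mult mult.commute[of 2])
qed

lemma angular_mean_lincomb:
  assumes "bounded_weight h1" "bounded_weight h2"
  shows "a *\<^sub>R angular_mean v \<epsilon> f h1 + b *\<^sub>R angular_mean v \<epsilon> f h2
    = angular_mean v \<epsilon> f (\<lambda>\<omega>. a * h1 \<omega> + b * h2 \<omega>)"
proof -
  have "(\<integral>\<omega>. ((a * h1 \<omega> + b * h2 \<omega>) * f \<omega>) *\<^sub>R oneL v \<epsilon> \<omega> \<partial>sphere_measure)
    = (\<integral>\<omega>. a *\<^sub>R ((h1 \<omega> * f \<omega>) *\<^sub>R oneL v \<epsilon> \<omega>) + b *\<^sub>R ((h2 \<omega> * f \<omega>) *\<^sub>R oneL v \<epsilon> \<omega>) \<partial>sphere_measure)"
    by (simp add: algebra_simps)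
  also have "\<dots> = a *\<^sub>R (\<integral>\<omega>. (h1 \<omega> * f \<omega>) *\<^sub>R oneL v \<epsilon> \<omega> \<partial>sphere_measure)
     + b *\<^sub>R (\<integral>\<omega>. (h2 \<omega> * f \<omega>) *\<^sub>R oneL v \<epsilon> \<omega> \<partial>sphere_measure)"
    unfolding Bochner_Integration.integral_add[OF
        integrable_scaleR_right[OF integrable_weight_oneL[OF assms(1)]]
        integrable_scaleR_right[OF integrable_weight_oneL[OF assms(2)]]]
    by (simp only: integral_scaleR_right)
  finally show ?thesis
    by (simp add: angular_mean_def sphere_mean_def scaleR_add_right mult.commute)
qed

lemma fst_angular_mean:
  assumes "bounded_weight h"
  shows "fst (angular_mean v \<epsilon> f h) = (1 / (4 * pi)) * (\<integral>\<omega>. h \<omega> * f \<omega> \<partial>sphere_measure)"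
  using integral_bounded_linear[OF bounded_linear_fst integrable_weight_oneL[OF assms]]
  by (simp add: angular_mean_def sphere_mean_def oneL_def)

lemma AE_weight_nonneg:
  assumes "\<And>\<omega>. \<omega> \<in> angles \<Longrightarrow> 0 \<le> h \<omega>"
  shows "AE \<omega> in sphere_measure. 0 \<le> h \<omega> * f \<omega>"
  using assms f by (intro AE_sphere_measure) (auto simp: densities_def)

lemma angular_mean_light_cone:
  assumes "bounded_weight h" "\<And>\<omega>. \<omega> \<in> angles \<Longrightarrow> 0 \<le> h \<omega>"
  shows "angular_mean v \<epsilon> f h \<in> light_cone"
proof -
  let ?I = "\<integral>\<omega>. (h \<omega> * f \<omega>) *\<^sub>R oneL v \<epsilon> \<omega> \<partial>sphere_measure"
  note int = integrable_weight_oneL[OF assms(1)]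
  have nn: "AE \<omega> in sphere_measure. 0 \<le> h \<omega> * f \<omega>" by (rule AE_weight_nonneg) fact
  have "norm (snd ?I) = norm (\<integral>\<omega>. snd ((h \<omega> * f \<omega>) *\<^sub>R oneL v \<epsilon> \<omega>) \<partial>sphere_measure)"
    using integral_bounded_linear[OF bounded_linear_snd int] by simp
  also have "\<dots> \<le> (\<integral>\<omega>. norm (snd ((h \<omega> * f \<omega>) *\<^sub>R oneL v \<epsilon> \<omega>)) \<partial>sphere_measure)"
    by (rule integral_norm_bound)
  also have "\<dots> = (\<integral>\<omega>. norm (h \<omega> * f \<omega>) \<partial>sphere_measure)"
    by (simp add: oneL_def norm_snd_Ldir[OF v \<epsilon>])
  also have "\<dots> = (\<integral>\<omega>. h \<omega> * f \<omega> \<partial>sphere_measure)"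
    using nn integrable_weight_density[OF assms(1)]
    by (intro integral_cong_AE) (auto elim: eventually_mono)
  also have "\<dots> = fst ?I"
    using integral_bounded_linear[OF bounded_linear_fst int] by (simp add: oneL_def)
  finally have "?I \<in> light_cone" by (simp add: light_cone_iff)
  then show ?thesis by (auto simp: angular_mean_def sphere_mean_def intro!: light_cone_scaleR)
qed

text \<open>Zero energy would force h f = 0 and hence f = 0 almost everywhere, against the positive
  mean required in \<open>densities\<close>. Weights with zeros on a null set are thereby
  allowed.\<close>

lemma angular_mean_realizable:
  assumes "bounded_weight h" "\<And>\<omega>. \<omega> \<in> angles \<Longrightarrow> 0 \<le> h \<omega>"
    and "AE \<omega> in lborel. \<omega> \<in> angles \<longrightarrow> h \<omega> \<noteq> 0"
  shows "angular_mean v \<epsilon> f h \<in> realizable"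
proof -
  have nn: "AE \<omega> in sphere_measure. 0 \<le> h \<omega> * f \<omega>" by (rule AE_weight_nonneg) fact
  note int = integrable_weight_density[OF assms(1)]
  have "(\<integral>\<omega>. h \<omega> * f \<omega> \<partial>sphere_measure) \<noteq> 0"
  proof
    assume "(\<integral>\<omega>. h \<omega> * f \<omega> \<partial>sphere_measure) = 0"
    then have "AE \<omega> in sphere_measure. h \<omega> * f \<omega> = 0"
      using integral_nonneg_eq_0_iff_AE[OF int nn] by simp
    moreover have "AE \<omega> in sphere_measure. h \<omega> \<noteq> 0" by (rule AE_sphere_measure) fact
    ultimately have "AE \<omega> in sphere_measure. f \<omega> = 0" by eventually_elim simp
    then have "(\<integral>\<omega>. f \<omega> \<partial>sphere_measure) = 0" by (rule integral_eq_zero_AE)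
    then show False using f by (simp add: densities_def sphere_mean_def)
  qed
  moreover have "0 \<le> (\<integral>\<omega>. h \<omega> * f \<omega> \<partial>sphere_measure)" using nn by (rule integral_nonneg_AE)
  ultimately show ?thesis
    using angular_mean_light_cone[OF assms(1,2)]
    by (simp add: realizable_iff fst_angular_mean[OF assms(1)])
qed

end

section \<open>Realizability of the moment fluxes\<close>

lemma finite_trig_roots:
  fixes a b c :: real
  assumes "a \<noteq> 0"
  shows "finite {t \<in> {0..pi}. a + b * cos t + c * sin t = 0}"
proof -
  let ?N = "{t \<in> {0..pi}. a + b * cos t + c * sin t = 0}"
  \<comment> \<open>Squaring \<open>a + b cos t = - c sin t\<close> gives a quadratic equation for \<open>cos t\<close>.\<close>
  let ?p = "[:a\<^sup>2 - c\<^sup>2, 2 * a * b, b\<^sup>2 + c\<^sup>2:]"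
  \<comment> \<open>The leading coefficient is 0 only for b = c = 0, and then the constant term is
    a^2, which is nonzero.\<close>
  have "?p \<noteq> 0"
    using assms by (auto simp: add_nonneg_eq_0_iff)
  then have "finite {x. poly ?p x = 0}" by (rule poly_roots_finite)
  moreover have "cos ` ?N \<subseteq> {x. poly ?p x = 0}"
  proof safe
    fix t assume "a + b * cos t + c * sin t = 0"
    then have "(a + b * cos t)\<^sup>2 = c\<^sup>2 * (sin t)\<^sup>2"
      by (metis add_eq_0_iff power2_minus power_mult_distrib)
    also have "\<dots> = c\<^sup>2 * (1 - (cos t)\<^sup>2)" by (simp add: sin_squared_eq)
    finally show "poly ?p (cos t) = 0"
      by (simp add: power2_eq_square algebra_simps)
  qed
  ultimately have "finite (cos ` ?N)" by (rule rev_finite_subset)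
  moreover have "inj_on cos ?N"
    by (rule inj_onI) (auto intro: cos_inj_pi)
  ultimately show ?thesis by (rule finite_imageD)
qed

lemma AE_affine_unit_dir_nonzero:
  assumes "A \<noteq> 0"
  shows "AE \<omega> in lborel. \<omega> \<in> angles \<longrightarrow> A + b \<bullet> unit_dir \<omega> \<noteq> 0"
proof -
  have meas [measurable]: "{\<omega> \<in> space (lborel \<Otimes>\<^sub>M lborel). \<omega> \<in> angles \<longrightarrow> A + b \<bullet> unit_dir \<omega> \<noteq> 0}
      \<in> sets (lborel \<Otimes>\<^sub>M lborel)"
    unfolding lborel_prod by measurable
  \<comment> \<open>For every fixed \<phi> the zeros in \<theta> are finitely many. At fixed
    \<theta> the expression may vanish for all \<phi>, for instance when \<open>b\<close> is
    parallel to the polar axis, so \<phi> is taken as the outer variable.\<close>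
  have "AE \<phi> in lborel. AE \<theta> in lborel. (\<theta>, \<phi>) \<in> angles \<longrightarrow> A + b \<bullet> unit_dir (\<theta>, \<phi>) \<noteq> 0"
  proof (rule AE_I2)
    fix \<phi> :: real
    let ?N = "{t \<in> {0..pi}. A + (b $ 1) * cos t + (b $ 2 * cos \<phi> + b $ 3 * sin \<phi>) * sin t = 0}"
    have "?N \<in> null_sets lborel"
      by (rule finite_imp_null_set_lborel[OF finite_trig_roots[OF assms]])
    then have "AE \<theta> in lborel. \<theta> \<notin> ?N" by (rule AE_not_in)
    then show "AE \<theta> in lborel. (\<theta>, \<phi>) \<in> angles \<longrightarrow> A + b \<bullet> unit_dir (\<theta>, \<phi>) \<noteq> 0"
      by eventually_elim
         (auto simp: angles_def unit_dir_def inner_vec_def sum_3 vector_3 algebra_simps)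
  qed
  \<comment> \<open>The product measure has \<theta> as its first factor, hence the exchange of the
    two quantifiers.\<close>
  then have "AE \<theta> in lborel. AE \<phi> in lborel. (\<theta>, \<phi>) \<in> angles \<longrightarrow> A + b \<bullet> unit_dir (\<theta>, \<phi>) \<noteq> 0"
    using meas
    by (subst lborel_pair.AE_commute[where P = "\<lambda>\<theta> \<phi>. (\<theta>, \<phi>) \<in> angles \<longrightarrow> A + b \<bullet> unit_dir (\<theta>, \<phi>) \<noteq> 0"])
       (simp_all add: space_pair_measure)
  then have "AE \<omega> in lborel \<Otimes>\<^sub>M lborel. \<omega> \<in> angles \<longrightarrow> A + b \<bullet> unit_dir \<omega> \<noteq> 0"
    by (rule lborel_pair.AE_pair_measure[rotated]) measurable
  then show ?thesis unfolding lborel_prod .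
qed

context
  fixes v :: "real^3" and \<epsilon> :: real and f :: "real \<times> real \<Rightarrow> real"
  assumes v: "norm v < 1" and \<epsilon>: "0 < \<epsilon>" and f: "f \<in> densities"
begin

lemma mom_U_eq: "mom_U v \<epsilon> f = angular_mean v \<epsilon> f (\<lambda>\<omega>. (1 / \<epsilon>) * (energy v \<epsilon> \<omega> * energy v \<epsilon> \<omega>))"
  by (simp add: mom_U_def angular_mean_def power2_eq_square)

lemma mom_F_eq: "mom_F v \<epsilon> f i = angular_mean v \<epsilon> f
    (\<lambda>\<omega>. (1 / \<epsilon>) * (energy v \<epsilon> \<omega> * energy v \<epsilon> \<omega>) * comp (Ldir v \<epsilon> \<omega>) i)"
  by (simp add: mom_F_def angular_mean_def power2_eq_square mult.commute mult.left_commute)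

lemma mom_Utilde_eq: "mom_Utilde v \<epsilon> f = angular_mean v \<epsilon> f (energy v \<epsilon>)"
  by (simp add: mom_Utilde_def angular_mean_def)

lemma mom_Feps_eq: "mom_Feps v G \<epsilon> f = - angular_mean v \<epsilon> f (\<lambda>\<omega>. qfun v G \<epsilon> \<omega> * energy v \<epsilon> \<omega>)"
  by (simp add: mom_Feps_def angular_mean_def)

text \<open>Multiplication by E clears the denominator of L: E (a + \<sigma> L^i) = a E + \<sigma>
  p^i is affine in the rest-frame direction. Its constant term is \<epsilon> W (a + \<sigma> v^i),
  nonzero because a \<ge> 1 > |v^i|.\<close>

lemma spatial_flux_realizable:
  assumes "0 < i" "1 \<le> a" "\<bar>\<sigma>\<bar> = 1"
  shows "a *\<^sub>R mom_U v \<epsilon> f + \<sigma> *\<^sub>R mom_F v \<epsilon> f i \<in> realizable"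
proof -
  let ?E = "energy v \<epsilon>" and ?L = "\<lambda>\<omega>. comp (Ldir v \<epsilon> \<omega>) i"
  define j :: 3 where "j = of_nat i"
  define W where "W = lorentz v"
  \<comment> \<open>Constant and linear part of that affine form: E contributes the terms with
    \<open>a\<close>, the momentum component those with \<sigma>.\<close>
  define A where "A = \<epsilon> * W * (a + \<sigma> * v $ j)"
  define b where "b = (\<epsilon> * (a * W + \<sigma> * boost_coeff v * v $ j)) *\<^sub>R v + (\<epsilon> * \<sigma>) *\<^sub>R axis j 1"
  have E: "0 < ?E \<omega>" for \<omega> by (rule energy_pos[OF v \<epsilon>])
  have L: "\<bar>?L \<omega>\<bar> \<le> 1" for \<omega>
    using assms(1) component_le_norm_cart[of "snd (Ldir v \<epsilon> \<omega>)" j]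
    by (simp add: comp_def norm_snd_Ldir[OF v \<epsilon>] j_def)
  have factor: "a * ((1 / \<epsilon>) * (?E \<omega> * ?E \<omega>)) + \<sigma> * ((1 / \<epsilon>) * (?E \<omega> * ?E \<omega>) * ?L \<omega>)
      = (1 / \<epsilon>) * (?E \<omega> * ?E \<omega>) * (a + \<sigma> * ?L \<omega>)" for \<omega>
    by (simp add: algebra_simps add_divide_distrib)
  have affine: "?E \<omega> * (a + \<sigma> * ?L \<omega>) = A + b \<bullet> unit_dir \<omega>" for \<omega>
  proof -
    have "?E \<omega> * ?L \<omega> = snd (momentum v \<epsilon> \<omega>) $ j"
      using assms(1) E[of \<omega>] by (simp add: comp_def snd_Ldir j_def)
    then have "?E \<omega> * (a + \<sigma> * ?L \<omega>) = a * ?E \<omega> + \<sigma> * snd (momentum v \<epsilon> \<omega>) $ j"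
      by (simp add: algebra_simps)
    then show ?thesis
      by (simp add: energy_eq snd_momentum A_def b_def W_def inner_add_left inner_axis' algebra_simps)
  qed
  have "\<bar>\<sigma> * v $ j\<bar> < 1"
    using assms(3) component_le_norm_cart[of v j] v by (simp add: abs_mult)
  then have "A \<noteq> 0" using assms(2) \<epsilon> lorentz_pos[OF v] by (simp add: A_def W_def)
  then have "AE \<omega> in lborel. \<omega> \<in> angles \<longrightarrow> ?E \<omega> * (a + \<sigma> * ?L \<omega>) \<noteq> 0"
    unfolding affine by (rule AE_affine_unit_dir_nonzero)
  then have ne: "AE \<omega> in lborel. \<omega> \<in> angles \<longrightarrow> (1 / \<epsilon>) * (?E \<omega> * ?E \<omega>) * (a + \<sigma> * ?L \<omega>) \<noteq> 0"
    by eventually_elim (use \<epsilon> in auto)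
  have nn: "0 \<le> (1 / \<epsilon>) * (?E \<omega> * ?E \<omega>) * (a + \<sigma> * ?L \<omega>)" for \<omega>
  proof -
    have "\<bar>\<sigma> * ?L \<omega>\<bar> \<le> 1" using L[of \<omega>] assms(3) by (simp add: abs_mult)
    then show ?thesis using assms(2) \<epsilon> by simp
  qed
  have "a *\<^sub>R mom_U v \<epsilon> f + \<sigma> *\<^sub>R mom_F v \<epsilon> f i
    = angular_mean v \<epsilon> f (\<lambda>\<omega>. (1 / \<epsilon>) * (?E \<omega> * ?E \<omega>) * (a + \<sigma> * ?L \<omega>))"
    unfolding mom_U_eq mom_F_eq factor[symmetric]
    by (intro angular_mean_lincomb v \<epsilon> f bounded_weight_intros bounded_weight_energy
        bounded_weight_Ldir assms(1))
  moreover have "angular_mean v \<epsilon> f (\<lambda>\<omega>. (1 / \<epsilon>) * (?E \<omega> * ?E \<omega>) * (a + \<sigma> * ?L \<omega>)) \<in> realizable"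
    by (intro angular_mean_realizable v \<epsilon> f bounded_weight_intros bounded_weight_energy
        bounded_weight_Ldir assms(1) nn ne)
  ultimately show ?thesis by simp
qed

text \<open>F^\<epsilon> carries a minus sign, so the combined weight is (a - \<sigma> q) E. It can
  vanish identically, for instance for a = q = 0, so only the closed cone can be claimed.\<close>

lemma spectral_flux_light_cone:
  assumes "\<And>\<omega>. \<omega> \<in> angles \<Longrightarrow> \<bar>qfun v G \<epsilon> \<omega>\<bar> \<le> a" "\<bar>\<sigma>\<bar> = 1"
  shows "a *\<^sub>R mom_Utilde v \<epsilon> f + \<sigma> *\<^sub>R mom_Feps v G \<epsilon> f \<in> light_cone"
proof -
  let ?h = "\<lambda>\<omega>. a * energy v \<epsilon> \<omega> + (- \<sigma>) * (qfun v G \<epsilon> \<omega> * energy v \<epsilon> \<omega>)"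
  have "0 \<le> ?h \<omega>" if "\<omega> \<in> angles" for \<omega>
  proof -
    have "\<sigma> * qfun v G \<epsilon> \<omega> \<le> a"
      using assms(1)[OF that] assms(2) abs_le_D1[of "\<sigma> * qfun v G \<epsilon> \<omega>" a] by (simp add: abs_mult)
    then have "0 \<le> (a - \<sigma> * qfun v G \<epsilon> \<omega>) * energy v \<epsilon> \<omega>"
      using energy_pos[OF v \<epsilon>, of \<omega>] by simp
    then show ?thesis by (simp add: algebra_simps)
  qed
  then have "angular_mean v \<epsilon> f ?h \<in> light_cone"
    by (intro angular_mean_light_cone v \<epsilon> f bounded_weight_intros bounded_weight_energy
        bounded_weight_qfun)
  moreover have "a *\<^sub>R mom_Utilde v \<epsilon> f + \<sigma> *\<^sub>R mom_Feps v G \<epsilon> f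
    = a *\<^sub>R angular_mean v \<epsilon> f (energy v \<epsilon>)
      + (- \<sigma>) *\<^sub>R angular_mean v \<epsilon> f (\<lambda>\<omega>. qfun v G \<epsilon> \<omega> * energy v \<epsilon> \<omega>)"
    by (simp add: mom_Utilde_eq mom_Feps_eq)
  moreover have "\<dots> = angular_mean v \<epsilon> f ?h"
    by (intro angular_mean_lincomb v \<epsilon> f bounded_weight_intros bounded_weight_energy
        bounded_weight_qfun)
  ultimately show ?thesis by simp
qed

text \<open>The combined weight is (a E / \<epsilon> - b) E, and the lower bound for E / \<epsilon>
  decides its sign. This absorbs the dissipation of Utilde into the cell average of U.\<close>

lemma number_density_light_cone:
  assumes "0 \<le> a" "b \<le> a * (lorentz v * (1 - norm v))"
  shows "a *\<^sub>R mom_U v \<epsilon> f - b *\<^sub>R mom_Utilde v \<epsilon> f \<in> light_cone"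
proof -
  let ?E = "energy v \<epsilon>"
  let ?h = "\<lambda>\<omega>. a * ((1 / \<epsilon>) * (?E \<omega> * ?E \<omega>)) + (- b) * ?E \<omega>"
  have "0 \<le> ?h \<omega>" for \<omega>
  proof -
    have "lorentz v * (1 - norm v) \<le> ?E \<omega> / \<epsilon>"
      using energy_lower_bound[OF v \<epsilon>, of \<omega>] \<epsilon> by (simp add: field_simps)
    then have "b \<le> a * (?E \<omega> / \<epsilon>)"
      using assms mult_left_mono order_trans by blast
    then have "0 \<le> (a * (?E \<omega> / \<epsilon>) - b) * ?E \<omega>"
      using energy_pos[OF v \<epsilon>, of \<omega>] by simp
    then show ?thesis by (simp add: algebra_simps)
  qed
  then have "angular_mean v \<epsilon> f ?h \<in> light_cone"
    by (intro angular_mean_light_cone v \<epsilon> f bounded_weight_intros bounded_weight_energy)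
  moreover have "a *\<^sub>R mom_U v \<epsilon> f - b *\<^sub>R mom_Utilde v \<epsilon> f
    = a *\<^sub>R angular_mean v \<epsilon> f (\<lambda>\<omega>. (1 / \<epsilon>) * (?E \<omega> * ?E \<omega>)) + (- b) *\<^sub>R angular_mean v \<epsilon> f ?E"
    unfolding mom_U_eq mom_Utilde_eq by simp
  moreover have "\<dots> = angular_mean v \<epsilon> f ?h"
    by (intro angular_mean_lincomb v \<epsilon> f bounded_weight_intros bounded_weight_energy)
  ultimately show ?thesis by simp
qed

end

section \<open>Cell averages as quadrature sums\<close>

definition lg_points :: "dg_scheme \<Rightarrow> element \<Rightarrow> nat set \<Rightarrow> point set" where
  "lg_points S K J = (\<lambda>\<xi>. \<lambda>m\<in>J. ref_to_cell K m (\<xi> m)) ` (\<Pi>\<^sub>E m\<in>J. lg_nodes (lg_num S))"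

lemma lg_quad_cong:
  assumes "\<And>y. y \<in> lg_points S K J \<Longrightarrow> h y = h' y"
  shows "lg_quad S K J h = lg_quad S K J h'"
  unfolding lg_quad_def by (rule sum.cong) (auto simp: assms lg_points_def)

lemma lg_quad_lincomb:
  "lg_quad S K J (\<lambda>y. a *\<^sub>R h y - b *\<^sub>R h' y) = a *\<^sub>R lg_quad S K J h - b *\<^sub>R lg_quad S K J h'"
  by (simp add: lg_quad_def scaleR_diff_right sum_subtractf scaleR_sum_right mult.commute)

lemma ref_to_cell_bounds:
  assumes "lo K m < hi K m" "- 1 < \<xi>" "\<xi> < 1"
  shows "lo K m < ref_to_cell K m \<xi>" "ref_to_cell K m \<xi> < hi K m"
proof -
  have "(1 + \<xi>) / 2 * width K m < 1 * width K m"
    using assms by (intro mult_strict_right_mono) (auto simp: width_def)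
  then show "ref_to_cell K m \<xi> < hi K m" by (simp add: ref_to_cell_def width_def)
  have "0 < (1 + \<xi>) / 2 * width K m" using assms by (simp add: width_def)
  then show "lo K m < ref_to_cell K m \<xi>" by (simp add: ref_to_cell_def)
qed

lemma ref_to_cell_1 [simp]: "ref_to_cell K m 1 = hi K m"
  by (simp add: ref_to_cell_def width_def)

lemma ref_to_cell_minus_1 [simp]: "ref_to_cell K m (- 1) = lo K m"
  by (simp add: ref_to_cell_def)

lemma lg_points_bounds:
  assumes "y \<in> lg_points S K J" "m \<in> J" "lo K m < hi K m"
  shows "lo K m < y m" "y m < hi K m"
  using assms lg_nodes_bounds[of _ "lg_num S"]
  by (auto simp: lg_points_def PiE_iff intro!: ref_to_cell_bounds)

lemma lg_points_tensor_points:
  assumes "y \<in> lg_points S K ({0..d} - {m})" "m \<le> d" "\<xi> \<in> B"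
  shows "y(m := ref_to_cell K m \<xi>) \<in> tensor_points d K ((\<lambda>_. lg_nodes (lg_num S))(m := B))"
proof -
  obtain \<eta> where \<eta>: "\<eta> \<in> (\<Pi>\<^sub>E m\<in>{0..d} - {m}. lg_nodes (lg_num S))"
    and y: "y = (\<lambda>m\<in>{0..d} - {m}. ref_to_cell K m (\<eta> m))"
    using assms(1) by (auto simp: lg_points_def)
  have "y(m := ref_to_cell K m \<xi>) = (\<lambda>m'\<in>{0..d}. ref_to_cell K m' ((\<eta>(m := \<xi>)) m'))"
    using assms(2) by (auto simp: y fun_eq_iff)
  moreover have "\<eta>(m := \<xi>) \<in> (\<Pi>\<^sub>E m'\<in>{0..d}. ((\<lambda>_. lg_nodes (lg_num S))(m := B)) m')"
    using \<eta> assms(2,3) by (auto simp: PiE_iff extensional_def)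
  ultimately show ?thesis unfolding tensor_points_def by (rule image_eqI)
qed

text \<open>Neighbours across a face share all tangential intervals, so their face quadrature points
  coincide and a trace from outside is a nodal value of the neighbour.\<close>

lemma lg_points_cong:
  assumes "\<And>m. m \<in> J \<Longrightarrow> lo K' m = lo K m \<and> hi K' m = hi K m"
  shows "lg_points S K' J = lg_points S K J"
  unfolding lg_points_def
  by (rule image_cong) (auto simp: fun_eq_iff assms ref_to_cell_def width_def)

context
  fixes S :: dg_scheme and K :: element and J :: "nat set"
  assumes J: "finite J" and box: "\<And>m. m \<in> J \<Longrightarrow> lo K m < hi K m"
begin

lemma lg_quad_weight_nonneg:
  assumes "\<xi> \<in> (\<Pi>\<^sub>E m\<in>J. lg_nodes (lg_num S))"
  shows "0 \<le> (\<Prod>m\<in>J. width K m * lg_weight (lg_num S) (\<xi> m))"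
  using assms box
  by (intro prod_nonneg mult_nonneg_nonneg lg_weight_nonneg) (auto simp: width_def PiE_iff less_imp_le)

lemma lg_quad_light_cone:
  assumes "\<And>y. y \<in> lg_points S K J \<Longrightarrow> h y \<in> light_cone"
  shows "lg_quad S K J h \<in> light_cone"
  unfolding lg_quad_def
  by (intro light_cone_sum light_cone_scaleR assms lg_quad_weight_nonneg) (auto simp: lg_points_def)

lemma lg_quad_realizable:
  assumes "lg_exact (lg_num S) n"
    and "\<And>y. y \<in> lg_points S K J \<Longrightarrow> h y \<in> realizable"
  shows "lg_quad S K J h \<in> realizable"
  unfolding lg_quad_def
proof (rule realizable_weighted_sum)
  show "finite (\<Pi>\<^sub>E m\<in>J. lg_nodes (lg_num S))" using J by (simp add: finite_PiE)
  \<comment> \<open>The weights are products over coordinates, so their total factorizes into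
    one-dimensional sums, each equal to a cell width.\<close>
  have "(\<Sum>\<xi>\<in>(\<Pi>\<^sub>E m\<in>J. lg_nodes (lg_num S)). \<Prod>m\<in>J. width K m * lg_weight (lg_num S) (\<xi> m))
    = (\<Prod>m\<in>J. \<Sum>\<xi>\<in>lg_nodes (lg_num S). width K m * lg_weight (lg_num S) \<xi>)"
    using J by (simp add: prod_sum_PiE)
  also have "\<dots> = (\<Prod>m\<in>J. width K m)"
    by (simp add: sum_distrib_left[symmetric] sum_lg_weight[OF assms(1)])
  also have "\<dots> > 0" using box by (intro prod_pos) (simp add: width_def)
  finally show "0 < (\<Sum>\<xi>\<in>(\<Pi>\<^sub>E m\<in>J. lg_nodes (lg_num S)). \<Prod>m\<in>J. width K m * lg_weight (lg_num S) (\<xi> m))" .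
qed (auto intro!: assms(2) lg_quad_weight_nonneg simp: lg_points_def)

end

section \<open>Reduction of cell integrals to one remaining coordinate\<close>

lemma set_integrable_monomial: "set_integrable lborel {a<..<b::real} (\<lambda>t. t ^ n)"
proof -
  have "set_integrable lborel {a..b} (\<lambda>t. t ^ n)"
    by (rule borel_integrable_atLeastAtMost') (intro continuous_intros)
  then show ?thesis by (rule set_integrable_subset) auto
qed

text \<open>On monomials the cell integral is a product of one-dimensional integrals. All but the
  \<open>m\<close>-th are replaced by LG sums, while coordinate \<open>m\<close> keeps its exact
  integral, where the LGL hypothesis can enter later.\<close>

lemma cell_integral_lg_quad:
  fixes K :: element
  assumes lg: "lg_exact (lg_num S) (k + 2)" and h: "tensor_polynomial d k h"
    and box: "\<And>m. m \<le> d \<Longrightarrow> lo K m < hi K m" and m: "m \<le> d"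
  shows "(LINT z:cell d K|PiM {0..d} (\<lambda>_. lborel). (z 0)\<^sup>2 *\<^sub>R h z)
    = lg_quad S K ({0..d} - {m})
        (\<lambda>y. LBINT t:{lo K m<..<hi K m}. ((y(m := t)) 0)\<^sup>2 *\<^sub>R h (y(m := t)))"
proof -
  interpret P: product_sigma_finite "\<lambda>_::nat. lborel :: real measure" ..
  obtain c where c: "\<And>z. h z = (\<Sum>\<alpha>\<in>(\<Pi>\<^sub>E m\<in>{0..d}. {..k}). (\<Prod>m\<in>{0..d}. z m ^ \<alpha> m) *\<^sub>R c \<alpha>)"
    using h by (auto simp: tensor_polynomial_def)
  let ?A = "\<Pi>\<^sub>E m\<in>{0..d}. {..k}" and ?J = "{0..d} - {m}"
  \<comment> \<open>The exponents with the weight \<epsilon>^2 absorbed: coordinate 0 gains 2, hence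
    the bound k + 2.\<close>
  define b :: "(nat \<Rightarrow> nat) \<Rightarrow> nat \<Rightarrow> nat" where "b \<alpha> m = \<alpha> m + (if m = 0 then 2 else 0)" for \<alpha> m
  define I where "I m n = (LBINT t:{lo K m<..<hi K m}. t ^ n)" for m n
  have expand: "(z 0)\<^sup>2 *\<^sub>R h z = (\<Sum>\<alpha>\<in>?A. (\<Prod>m\<in>{0..d}. z m ^ b \<alpha> m) *\<^sub>R c \<alpha>)" for z
  proof -
    have "(\<Prod>m\<in>{0..d}. z m ^ b \<alpha> m) = (z 0)\<^sup>2 * (\<Prod>m\<in>{0..d}. z m ^ \<alpha> m)" for \<alpha>
    proof -
      have "(\<Prod>m\<in>{0..d}. z m ^ b \<alpha> m) = (\<Prod>m\<in>{0..d}. z m ^ \<alpha> m * (if m = 0 then (z m)\<^sup>2 else 1))"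
        by (intro prod.cong) (auto simp: b_def power_add)
      then show ?thesis by (simp add: prod.distrib prod.delta)
    qed
    then show ?thesis by (simp add: c scaleR_sum_right)
  qed
  have b_le: "b \<alpha> m' \<le> k + 2" if "\<alpha> \<in> ?A" "m' \<le> d" for \<alpha> m'
  proof -
    have "\<alpha> m' \<le> k" using that by (auto simp: PiE_iff)
    then show ?thesis by (auto simp: b_def)
  qed
  have I_lg: "I m' (b \<alpha> m')
      = (\<Sum>\<xi>\<in>lg_nodes (lg_num S). width K m' * lg_weight (lg_num S) \<xi> * ref_to_cell K m' \<xi> ^ b \<alpha> m')"
    if "\<alpha> \<in> ?A" "m' \<le> d" for \<alpha> m'
    unfolding I_def by (rule lg_exact_cell[OF lg b_le[OF that] box[OF that(2)]])
  have int: "integrable lborel (\<lambda>t. indicator {lo K m'<..<hi K m'} t * t ^ n)" for m' n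
    using set_integrable_monomial by (simp add: set_integrable_def)
  have I_alt: "I m' n = (\<integral>t. indicator {lo K m'<..<hi K m'} t * t ^ n \<partial>lborel)" for m' n
    by (simp add: I_def set_lebesgue_integral_def)
  have "(LINT z:cell d K|PiM {0..d} (\<lambda>_. lborel). (z 0)\<^sup>2 *\<^sub>R h z)
    = (\<integral>z. (\<Sum>\<alpha>\<in>?A. (\<Prod>m\<in>{0..d}. indicator {lo K m<..<hi K m} (z m) * z m ^ b \<alpha> m) *\<^sub>R c \<alpha>)
        \<partial>PiM {0..d} (\<lambda>_. lborel))"
    unfolding set_lebesgue_integral_def
  proof (rule Bochner_Integration.integral_cong[OF refl])
    fix z :: point assume "z \<in> space (PiM {0..d} (\<lambda>_. lborel))"
    then have "indicator (cell d K) z = (\<Prod>m\<in>{0..d}. indicator {lo K m<..<hi K m} (z m) :: real)"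
      by (auto simp: cell_def space_PiM PiE_iff indicator_def prod_zero_iff)
    then show "indicator (cell d K) z *\<^sub>R (z 0)\<^sup>2 *\<^sub>R h z
      = (\<Sum>\<alpha>\<in>?A. (\<Prod>m\<in>{0..d}. indicator {lo K m<..<hi K m} (z m) * z m ^ b \<alpha> m) *\<^sub>R c \<alpha>)"
      by (simp add: expand scaleR_sum_right prod.distrib)
  qed
  also have "\<dots> = (\<Sum>\<alpha>\<in>?A. \<integral>z. (\<Prod>m\<in>{0..d}. indicator {lo K m<..<hi K m} (z m) * z m ^ b \<alpha> m) *\<^sub>R c \<alpha>
        \<partial>PiM {0..d} (\<lambda>_. lborel))"
    by (intro Bochner_Integration.integral_sum integrable_scaleR_left P.product_integrable_prod int) auto
  also have "\<dots> = (\<Sum>\<alpha>\<in>?A. (\<Prod>m\<in>{0..d}. I m (b \<alpha> m)) *\<^sub>R c \<alpha>)"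
  proof (rule sum.cong[OF refl])
    fix \<alpha>
    have "(\<integral>z. (\<Prod>m\<in>{0..d}. indicator {lo K m<..<hi K m} (z m) * z m ^ b \<alpha> m) *\<^sub>R c \<alpha>
        \<partial>PiM {0..d} (\<lambda>_. lborel))
      = (\<integral>z. (\<Prod>m\<in>{0..d}. indicator {lo K m<..<hi K m} (z m) * z m ^ b \<alpha> m)
        \<partial>PiM {0..d} (\<lambda>_. lborel)) *\<^sub>R c \<alpha>"
      by (rule integral_scaleR_left) (intro P.product_integrable_prod int, simp)
    also have "(\<integral>z. (\<Prod>m\<in>{0..d}. indicator {lo K m<..<hi K m} (z m) * z m ^ b \<alpha> m)
        \<partial>PiM {0..d} (\<lambda>_. lborel)) = (\<Prod>m\<in>{0..d}. I m (b \<alpha> m))"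
      unfolding I_alt by (intro P.product_integral_prod int) simp
    finally show "(\<integral>z. (\<Prod>m\<in>{0..d}. indicator {lo K m<..<hi K m} (z m) * z m ^ b \<alpha> m) *\<^sub>R c \<alpha>
        \<partial>PiM {0..d} (\<lambda>_. lborel)) = (\<Prod>m\<in>{0..d}. I m (b \<alpha> m)) *\<^sub>R c \<alpha>" .
  qed
  also have "\<dots> = (\<Sum>\<alpha>\<in>?A. \<Sum>\<xi>\<in>(\<Pi>\<^sub>E m\<in>?J. lg_nodes (lg_num S)).
      ((\<Prod>m'\<in>?J. width K m' * lg_weight (lg_num S) (\<xi> m') * ref_to_cell K m' (\<xi> m') ^ b \<alpha> m')
        * I m (b \<alpha> m)) *\<^sub>R c \<alpha>)"
  proof (rule sum.cong[OF refl])
    fix \<alpha> assume \<alpha>: "\<alpha> \<in> ?A"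
    have "(\<Prod>m\<in>{0..d}. I m (b \<alpha> m)) = (\<Prod>m'\<in>?J. I m' (b \<alpha> m')) * I m (b \<alpha> m)"
      using m by (simp add: prod.remove[of "{0..d}" m] mult.commute)
    also have "(\<Prod>m'\<in>?J. I m' (b \<alpha> m')) = (\<Prod>m'\<in>?J. \<Sum>\<xi>\<in>lg_nodes (lg_num S).
        width K m' * lg_weight (lg_num S) \<xi> * ref_to_cell K m' \<xi> ^ b \<alpha> m')"
      using \<alpha> by (intro prod.cong refl I_lg) auto
    also have "\<dots> = (\<Sum>\<xi>\<in>(\<Pi>\<^sub>E m\<in>?J. lg_nodes (lg_num S)). \<Prod>m'\<in>?J.
        width K m' * lg_weight (lg_num S) (\<xi> m') * ref_to_cell K m' (\<xi> m') ^ b \<alpha> m')"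
      by (rule prod_sum_PiE) auto
    finally show "(\<Prod>m\<in>{0..d}. I m (b \<alpha> m)) *\<^sub>R c \<alpha> = (\<Sum>\<xi>\<in>(\<Pi>\<^sub>E m\<in>?J. lg_nodes (lg_num S)).
      ((\<Prod>m'\<in>?J. width K m' * lg_weight (lg_num S) (\<xi> m') * ref_to_cell K m' (\<xi> m') ^ b \<alpha> m')
        * I m (b \<alpha> m)) *\<^sub>R c \<alpha>)"
      by (simp add: sum_distrib_right scaleR_sum_left)
  qed
  also have "\<dots> = (\<Sum>\<xi>\<in>(\<Pi>\<^sub>E m\<in>?J. lg_nodes (lg_num S)). \<Sum>\<alpha>\<in>?A.
      ((\<Prod>m'\<in>?J. width K m' * lg_weight (lg_num S) (\<xi> m') * ref_to_cell K m' (\<xi> m') ^ b \<alpha> m')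
        * I m (b \<alpha> m)) *\<^sub>R c \<alpha>)"
    by (rule sum.swap)
  also have "\<dots> = lg_quad S K ?J
        (\<lambda>y. \<Sum>\<alpha>\<in>?A. ((\<Prod>m'\<in>?J. y m' ^ b \<alpha> m') * I m (b \<alpha> m)) *\<^sub>R c \<alpha>)"
    by (simp add: lg_quad_def scaleR_sum_right prod.distrib mult.assoc)
  \<comment> \<open>The expansion is now read backwards: with the other coordinates frozen,
    \<open>I m\<close> is again an integral in coordinate \<open>m\<close>. The identity holds for
    every \<open>y\<close>, hence as an equation of functions under \<open>lg_quad\<close>.\<close>
  also have "(\<lambda>y. \<Sum>\<alpha>\<in>?A. ((\<Prod>m'\<in>?J. y m' ^ b \<alpha> m') * I m (b \<alpha> m)) *\<^sub>R c \<alpha>)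
    = (\<lambda>y. LBINT t:{lo K m<..<hi K m}. ((y(m := t)) 0)\<^sup>2 *\<^sub>R h (y(m := t)))"
  proof
    fix y :: point
    have "indicator {lo K m<..<hi K m} t *\<^sub>R ((y(m := t)) 0)\<^sup>2 *\<^sub>R h (y(m := t))
      = (\<Sum>\<alpha>\<in>?A. (\<Prod>m'\<in>?J. y m' ^ b \<alpha> m') *\<^sub>R (indicator {lo K m<..<hi K m} t * t ^ b \<alpha> m) *\<^sub>R c \<alpha>)" for t
    proof -
      have "(\<Prod>m'\<in>{0..d}. (y(m := t)) m' ^ b \<alpha> m') = t ^ b \<alpha> m * (\<Prod>m'\<in>?J. y m' ^ b \<alpha> m')" for \<alpha>
        using m by (simp add: prod.remove[of "{0..d}" m])
      then show ?thesis
        unfolding expand by (simp add: scaleR_sum_right mult.assoc mult.commute mult.left_commute)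
    qed
    then have "(LBINT t:{lo K m<..<hi K m}. ((y(m := t)) 0)\<^sup>2 *\<^sub>R h (y(m := t)))
      = (\<integral>t. (\<Sum>\<alpha>\<in>?A. (\<Prod>m'\<in>?J. y m' ^ b \<alpha> m') *\<^sub>R (indicator {lo K m<..<hi K m} t * t ^ b \<alpha> m) *\<^sub>R c \<alpha>) \<partial>lborel)"
      by (simp only: set_lebesgue_integral_def)
    also have "\<dots> = (\<Sum>\<alpha>\<in>?A. \<integral>t. (\<Prod>m'\<in>?J. y m' ^ b \<alpha> m') *\<^sub>R (indicator {lo K m<..<hi K m} t * t ^ b \<alpha> m) *\<^sub>R c \<alpha> \<partial>lborel)"
      by (intro Bochner_Integration.integral_sum integrable_scaleR_right integrable_scaleR_left int)
    also have "\<dots> = (\<Sum>\<alpha>\<in>?A. (\<Prod>m'\<in>?J. y m' ^ b \<alpha> m') *\<^sub>R I m (b \<alpha> m) *\<^sub>R c \<alpha>)"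
      unfolding I_alt integral_scaleR_right by (simp only: integral_scaleR_left[OF int])
    finally show "(\<Sum>\<alpha>\<in>?A. ((\<Prod>m'\<in>?J. y m' ^ b \<alpha> m') * I m (b \<alpha> m)) *\<^sub>R c \<alpha>)
      = (LBINT t:{lo K m<..<hi K m}. ((y(m := t)) 0)\<^sup>2 *\<^sub>R h (y(m := t)))" by simp
  qed
  finally show ?thesis .
qed

lemma lg_points_extensional: "y \<in> lg_points S K J \<Longrightarrow> y \<in> extensional J"
  by (auto simp: lg_points_def)

lemma lg_points_closed_cell:
  assumes "y \<in> lg_points S K ({0..d} - {m})" "m \<le> d" "\<And>m. m \<le> d \<Longrightarrow> lo K m < hi K m"
    and "lo K m \<le> t" "t \<le> hi K m"
  shows "y(m := t) \<in> closed_cell d K"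
proof -
  have "lo K m' \<le> y m' \<and> y m' \<le> hi K m'" if "m' \<in> {0..d} - {m}" for m'
    using lg_points_bounds[OF assms(1) that] assms(3)[of m'] that by (simp add: less_imp_le)
  moreover have "y \<in> extensional ({0..d} - {m})" by (rule lg_points_extensional[OF assms(1)])
  ultimately show ?thesis
    using assms(2,4,5) by (auto simp: closed_cell_def PiE_iff extensional_def)
qed

lemma lg_points_space_cell:
  assumes "y \<in> lg_points S K ({0..d} - {0})" "\<And>m. m \<le> d \<Longrightarrow> lo K m < hi K m"
  shows "space_part d (y(0 := t)) \<in> space_cell d K"
proof -
  have "lo K m < y m \<and> y m < hi K m" if "m \<in> {1..d}" for m
    using lg_points_bounds[OF assms(1), of m] assms(2)[of m] that by simp
  then show ?thesis by (auto simp: space_part_def space_cell_def)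
qed

text \<open>By LG exactness for \<epsilon>^2 the volume is a sum of nonnegative terms. Some weight
  is positive since they sum to 1, and its node is interior, so \<epsilon> > 0 there even if
  \<open>lo K 0 = 0\<close>.\<close>

lemma eps_volume_pos:
  assumes "lg_exact (lg_num S) (k + 2)" "0 \<le> lo K 0" "lo K 0 < hi K 0"
  shows "0 < eps_volume K"
proof -
  let ?N = "lg_nodes (lg_num S)" and ?w = "lg_weight (lg_num S)"
  have w: "0 < width K 0" using assms(3) by (simp add: width_def)
  have vol: "eps_volume K = (\<Sum>\<xi>\<in>?N. width K 0 * ?w \<xi> * (ref_to_cell K 0 \<xi>)\<^sup>2)"
    unfolding eps_volume_def by (rule lg_exact_cell[OF assms(1) _ assms(3)]) simp
  have pos: "0 < ref_to_cell K 0 \<xi>" if "\<xi> \<in> ?N" for \<xi>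
    using ref_to_cell_bounds(1)[OF assms(3) lg_nodes_bounds[OF that]] assms(2) by simp
  have "\<not> (\<forall>\<xi>\<in>?N. ?w \<xi> = 0)"
    using sum_lg_weight[OF assms(1)] by (metis sum.neutral zero_neq_one)
  then obtain \<xi> where \<xi>: "\<xi> \<in> ?N" "?w \<xi> \<noteq> 0" by blast
  have "0 < width K 0 * ?w \<xi> * (ref_to_cell K 0 \<xi>)\<^sup>2"
    using w \<xi> lg_weight_nonneg[OF \<xi>(1)] pos[OF \<xi>(1)] by simp
  then show ?thesis
    unfolding vol using w by (intro sum_pos2[OF _ \<xi>(1)]) (auto simp: lg_weight_nonneg)
qed

context
  fixes S :: dg_scheme and U :: field and K :: element and k :: nat
  assumes lg: "lg_exact (lg_num S) (k + 2)"
    and poly: "tensor_polynomial (space_dim S) k (U K)"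
    and box: "\<And>m. m \<le> space_dim S \<Longrightarrow> lo K m < hi K m" and eps: "0 \<le> lo K 0"
begin

lemma volume_pos: "0 < volume (space_dim S) K"
proof -
  have "0 < (\<Prod>l\<in>{1..space_dim S}. width K l)"
    using box by (intro prod_pos) (simp add: width_def)
  then show ?thesis using eps_volume_pos[OF lg eps box] by (simp add: volume_def)
qed

lemma volume_cell_average:
  assumes "m \<le> space_dim S"
  shows "volume (space_dim S) K *\<^sub>R cell_average (space_dim S) U K
    = lg_quad S K ({0..space_dim S} - {m})
        (\<lambda>y. LBINT t:{lo K m<..<hi K m}. ((y(m := t)) 0)\<^sup>2 *\<^sub>R U K (y(m := t)))"
  using volume_pos cell_integral_lg_quad[OF lg poly box assms] by (simp add: cell_average_def)

text \<open>For l \<ge> 1 the factor \<epsilon>^2 does not depend on the integrated coordinate and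
  stays outside the LGL sum; in the energy version it becomes part of the LGL weights.\<close>

lemma cell_average_lgl_x:
  assumes l: "l \<in> {1..space_dim S}" and exact: "lgl_exact_x S U K l"
  shows "volume (space_dim S) K *\<^sub>R cell_average (space_dim S) U K
    = lg_quad S K ({0..space_dim S} - {l}) (\<lambda>y. (y 0)\<^sup>2 *\<^sub>R width K l *\<^sub>R
        (\<Sum>\<xi>\<in>lgl_nodes (lgl_num_x S). lgl_weight (lgl_num_x S) \<xi> *\<^sub>R U K (y(l := ref_to_cell K l \<xi>))))"
proof -
  have w: "0 < width K l" using box l by (simp add: width_def)
  have "(LBINT t:{lo K l<..<hi K l}. ((y(l := t)) 0)\<^sup>2 *\<^sub>R U K (y(l := t)))
    = (y 0)\<^sup>2 *\<^sub>R width K l *\<^sub>R (\<Sum>\<xi>\<in>lgl_nodes (lgl_num_x S).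
        lgl_weight (lgl_num_x S) \<xi> *\<^sub>R U K (y(l := ref_to_cell K l \<xi>)))"
    if "y \<in> lg_points S K ({0..space_dim S} - {l})" for y
  proof -
    \<comment> \<open>The exactness hypothesis speaks about points of the closed cell. Coordinate
      \<open>l\<close> is overwritten there, so \<open>lo K l\<close> merely completes
      \<open>y\<close> to such a point.\<close>
    have "y(l := lo K l) \<in> closed_cell (space_dim S) K"
      using that l box by (intro lg_points_closed_cell) (auto intro: less_imp_le)
    then have "(1 / width K l) *\<^sub>R (LBINT t:{lo K l<..<hi K l}. U K (y(l := t)))
      = (\<Sum>\<xi>\<in>lgl_nodes (lgl_num_x S).
        lgl_weight (lgl_num_x S) \<xi> *\<^sub>R U K (y(l := ref_to_cell K l \<xi>)))"
      (is "_ *\<^sub>R ?I = ?Q") using exact by (force simp: lgl_exact_x_def)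
    then have "width K l *\<^sub>R (1 / width K l) *\<^sub>R ?I = width K l *\<^sub>R ?Q" by (simp only:)
    then have "?I = width K l *\<^sub>R ?Q" using w by simp
    moreover have "(LBINT t:{lo K l<..<hi K l}. ((y(l := t)) 0)\<^sup>2 *\<^sub>R U K (y(l := t)))
      = (y 0)\<^sup>2 *\<^sub>R (LBINT t:{lo K l<..<hi K l}. U K (y(l := t)))"
      using l by simp
    ultimately show ?thesis by simp
  qed
  then show ?thesis using l by (auto simp: volume_cell_average[of l] cong: lg_quad_cong)
qed

lemma cell_average_lgl_eps:
  assumes exact: "lgl_exact_eps S U K"
  shows "volume (space_dim S) K *\<^sub>R cell_average (space_dim S) U K
    = lg_quad S K ({0..space_dim S} - {0}) (\<lambda>y. width K 0 *\<^sub>R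
        (\<Sum>\<xi>\<in>lgl_nodes (lgl_num_eps S). (lgl_weight (lgl_num_eps S) \<xi> * (ref_to_cell K 0 \<xi>)\<^sup>2) *\<^sub>R
           U K (y(0 := ref_to_cell K 0 \<xi>))))"
proof -
  have vol: "0 < eps_volume K" using eps_volume_pos[OF lg eps box] by simp
  have "(LBINT t:{lo K 0<..<hi K 0}. ((y(0 := t)) 0)\<^sup>2 *\<^sub>R U K (y(0 := t)))
    = width K 0 *\<^sub>R (\<Sum>\<xi>\<in>lgl_nodes (lgl_num_eps S).
        (lgl_weight (lgl_num_eps S) \<xi> * (ref_to_cell K 0 \<xi>)\<^sup>2) *\<^sub>R U K (y(0 := ref_to_cell K 0 \<xi>)))"
    (is "?I = _ *\<^sub>R ?Q") if "y \<in> lg_points S K ({0..space_dim S} - {0})" for y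
  proof -
    have "y(0 := lo K 0) \<in> closed_cell (space_dim S) K"
      using that box by (intro lg_points_closed_cell) (auto intro: less_imp_le)
    then have "(1 / eps_volume K) *\<^sub>R ?I = (width K 0 / eps_volume K) *\<^sub>R ?Q"
      using exact by (force simp: lgl_exact_eps_def)
    then have "eps_volume K *\<^sub>R (1 / eps_volume K) *\<^sub>R ?I
        = eps_volume K *\<^sub>R (width K 0 / eps_volume K) *\<^sub>R ?Q" by (simp only:)
    then show ?thesis using vol by simp
  qed
  then show ?thesis by (auto simp: volume_cell_average[of 0] cong: lg_quad_cong)
qed

end

section \<open>Numerical fluxes\<close>

text \<open>At \<open>\<epsilon> = 0\<close> no closure is required: the energy flux through such a face has the factor
  \<open>\<epsilon>\<^sup>3 = 0\<close>.\<close>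

definition admissible :: "dg_scheme \<Rightarrow> point \<Rightarrow> state \<Rightarrow> bool" where
  "admissible S z V \<longleftrightarrow> V \<in> realizable \<and> (0 < z 0 \<longrightarrow> exact_closure S z V)"

text \<open>\<open>X\<close> is the dissipated quantity, Utilde in energy and \<open>V\<close>
  itself in space, so one identity serves both. Half of \<mu> a X is dissipation of the inner trace,
  the other half completes its flux to a X - F. The scalar -1 is kept to match \<sigma> in the flux
  lemmas; pairing with an arbitrary vector reduces the identity to real algebra.\<close>

lemma lax_friedrichs_above:
  fixes V X :: "'a::real_inner"
  shows "c *\<^sub>R V - \<mu> *\<^sub>R ((1/2) *\<^sub>R (F + F' - a *\<^sub>R (X' - X)))
    = (c *\<^sub>R V - (\<mu> * a) *\<^sub>R X) + (\<mu> / 2) *\<^sub>R (a *\<^sub>R X + (- 1) *\<^sub>R F) + (\<mu> / 2) *\<^sub>R (a *\<^sub>R X' + (- 1) *\<^sub>R F')"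
  by (subst vector_eq_ldot[symmetric])
     (simp add: inner_add_right inner_diff_right field_simps)

lemma lax_friedrichs_below:
  fixes V X :: "'a::real_inner"
  shows "c *\<^sub>R V + \<mu> *\<^sub>R ((1/2) *\<^sub>R (F' + F - a *\<^sub>R (X - X')))
    = (c *\<^sub>R V - (\<mu> * a) *\<^sub>R X) + (\<mu> / 2) *\<^sub>R (a *\<^sub>R X + 1 *\<^sub>R F) + (\<mu> / 2) *\<^sub>R (a *\<^sub>R X' + 1 *\<^sub>R F')"
  by (subst vector_eq_ldot[symmetric])
     (simp add: inner_add_right inner_diff_right field_simps)

lemma flux_x_realizable:
  assumes "admissible S z V" "0 < z 0" "norm (vel S (space_part (space_dim S) z)) < 1"
    and "0 < l" "1 \<le> a" "\<bar>\<sigma>\<bar> = 1"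
  shows "a *\<^sub>R V + \<sigma> *\<^sub>R flux_x S l z V \<in> realizable"
proof -
  let ?x = "space_part (space_dim S) z"
  let ?f = "closure_f S (z 0) ?x V"
  have f: "?f \<in> densities" and V: "V = mom_U (vel S ?x) (z 0) ?f"
    using assms(1,2) by (simp_all add: admissible_def exact_closure_def Let_def)
  have "a *\<^sub>R mom_U (vel S ?x) (z 0) ?f + \<sigma> *\<^sub>R mom_F (vel S ?x) (z 0) ?f l \<in> realizable"
    by (rule spatial_flux_realizable[OF assms(3,2) f assms(4-6)])
  then show ?thesis unfolding V[symmetric] by (simp add: flux_x_def Let_def)
qed

text \<open>The multiple c - \<mu> a of \<open>V\<close> may be 0, so for \<mu> > 0 positive energy
  is drawn from a U + \<sigma> F. For \<mu> = 0, which occurs when a stage coefficient is 0, it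
  comes from c V.\<close>

lemma numflux_x_realizable:
  assumes V: "admissible S z V" "admissible S z V'" and z: "0 < z 0"
    and v: "norm (vel S (space_part (space_dim S) z)) < 1"
    and l: "0 < l" "1 \<le> speed_x S l"
    and c: "0 < c" "0 \<le> \<mu>" "\<mu> * speed_x S l \<le> c"
  shows "c *\<^sub>R V - \<mu> *\<^sub>R numflux_x S l z V V' \<in> realizable"
    and "c *\<^sub>R V + \<mu> *\<^sub>R numflux_x S l z V' V \<in> realizable"
proof -
  let ?a = "speed_x S l"
  have *: "(c *\<^sub>R V - (\<mu> * ?a) *\<^sub>R V) + (\<mu> / 2) *\<^sub>R (?a *\<^sub>R V + \<sigma> *\<^sub>R flux_x S l z V)
      + (\<mu> / 2) *\<^sub>R (?a *\<^sub>R V' + \<sigma> *\<^sub>R flux_x S l z V') \<in> realizable" if \<sigma>: "\<bar>\<sigma>\<bar> = 1" for \<sigma>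
  proof (cases "\<mu> = 0")
    case True
    then show ?thesis using V(1) c(1) by (simp add: admissible_def realizable_scaleR)
  next
    case False
    note G = flux_x_realizable[OF _ z v l \<sigma>]
    have "(\<mu> / 2) *\<^sub>R (?a *\<^sub>R V + \<sigma> *\<^sub>R flux_x S l z V) + (c - \<mu> * ?a) *\<^sub>R V
      + (\<mu> / 2) *\<^sub>R (?a *\<^sub>R V' + \<sigma> *\<^sub>R flux_x S l z V') \<in> realizable"
      using False c V
      by (intro realizable_add realizable_scaleR light_cone_scaleR realizable_light_cone G)
         (auto simp: admissible_def)
    then show ?thesis by (simp add: scaleR_diff_left add.commute)
  qed
  show "c *\<^sub>R V - \<mu> *\<^sub>R numflux_x S l z V V' \<in> realizable"
    unfolding numflux_x_def lax_friedrichs_above by (rule *) simp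
  show "c *\<^sub>R V + \<mu> *\<^sub>R numflux_x S l z V' V \<in> realizable"
    unfolding numflux_x_def lax_friedrichs_below by (rule *) simp
qed

text \<open>To be applied with \<open>\<mu>\<close> equal to the scaled time step times the face
  energy: one of the three powers of \<epsilon> in the flux is moved into it.\<close>

lemma numflux_eps_light_cone:
  fixes S :: dg_scheme and z :: point
  defines "x \<equiv> space_part (space_dim S) z"
  assumes V: "admissible S z V" "admissible S z V'" and z: "0 < z 0"
    and v: "norm (vel S x) < 1"
    and a: "\<And>\<omega>. \<omega> \<in> angles \<Longrightarrow> \<bar>qfun (vel S x) (grad_u S x) (z 0) \<omega>\<bar> \<le> speed_eps S x"
    and c: "0 \<le> c" "0 \<le> \<mu>" "\<mu> * speed_eps S x \<le> c * (lorentz (vel S x) * (1 - norm (vel S x)))"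
  shows "c *\<^sub>R V - \<mu> *\<^sub>R numflux_eps S z V V' \<in> light_cone"
    and "c *\<^sub>R V + \<mu> *\<^sub>R numflux_eps S z V' V \<in> light_cone"
proof -
  have f: "closure_f S (z 0) x X \<in> densities" and mom: "mom_U (vel S x) (z 0) (closure_f S (z 0) x X) = X"
    if "admissible S z X" for X
    using that z by (auto simp: admissible_def exact_closure_def Let_def x_def)
  have *: "speed_eps S x *\<^sub>R Utilde S z X + \<sigma> *\<^sub>R flux_eps S z X \<in> light_cone"
    if "admissible S z X" "\<bar>\<sigma>\<bar> = 1" for X \<sigma>
    using spectral_flux_light_cone[OF v z f[OF that(1)] a that(2)]
    by (simp add: Utilde_def flux_eps_def Let_def x_def)
  have **: "c *\<^sub>R V - (\<mu> * speed_eps S x) *\<^sub>R Utilde S z V \<in> light_cone"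
    using number_density_light_cone[OF v z f[OF V(1)] c(1,3)]
    unfolding mom[OF V(1)] by (simp add: Utilde_def Let_def x_def)
  show "c *\<^sub>R V - \<mu> *\<^sub>R numflux_eps S z V V' \<in> light_cone"
    unfolding numflux_eps_def x_def[symmetric] lax_friedrichs_above
    using c(2) V by (intro light_cone_add light_cone_scaleR * **) auto
  show "c *\<^sub>R V + \<mu> *\<^sub>R numflux_eps S z V' V \<in> light_cone"
    unfolding numflux_eps_def x_def[symmetric] lax_friedrichs_below
    using c(2) V by (intro light_cone_add light_cone_scaleR * **) auto
qed

section \<open>Face contributions\<close>

lemma lgl_nodes_ends: "1 \<in> lgl_nodes M" "- 1 \<in> lgl_nodes M"
  by (simp_all add: lgl_nodes_def)

lemma sum_lgl_nodes:
  fixes h :: "real \<Rightarrow> 'a::comm_monoid_add"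
  assumes "2 \<le> M"
  shows "(\<Sum>\<xi>\<in>lgl_nodes M. h \<xi>) = h 1 + h (- 1) + (\<Sum>\<xi>\<in>lgl_nodes M - {1, - 1}. h \<xi>)"
  using sum.subset_diff[of "{1, - 1}" "lgl_nodes M" h] assms
  by (simp add: lgl_nodes_ends add.commute)

definition lgl_num :: "dg_scheme \<Rightarrow> nat \<Rightarrow> nat" where
  "lgl_num S m = (if m = 0 then lgl_num_eps S else lgl_num_x S)"

lemma lg_points_S_tilde:
  assumes "y \<in> lg_points S K ({0..space_dim S} - {m})" "m \<le> space_dim S"
    and "\<xi> \<in> lgl_nodes (lgl_num S m)"
  shows "y(m := ref_to_cell K m \<xi>) \<in> S_tilde S K"
  using lg_points_tensor_points[OF assms] assms(2)
  by (cases "m = 0") (auto simp: S_tilde_def S_hat_eps_def S_hat_x_def lgl_num_def)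

context
  fixes S :: dg_scheme and U :: field and g :: "point \<Rightarrow> state"
  assumes mesh: "valid_mesh (space_dim S) (mesh S)"
    and interior: "\<And>K z. K \<in> mesh S \<Longrightarrow> z \<in> S_tilde S K \<Longrightarrow> admissible S z (U K z)"
    and exterior: "\<And>z. z \<in> boundary_points S \<Longrightarrow> admissible S z (g z)"
begin

section \<open>Admissibility of face values and exterior traces\<close>

lemma mesh_box:
  assumes "K \<in> mesh S"
  shows "0 \<le> lo K 0" "m \<le> space_dim S \<Longrightarrow> lo K m < hi K m"
  using mesh assms by (auto simp: valid_mesh_def)

lemma lg_points_eps_pos:
  assumes "K \<in> mesh S" "y \<in> lg_points S K ({0..space_dim S} - {l})" "0 < l"
  shows "0 < y 0"
  using lg_points_bounds(1)[OF assms(2), of 0] mesh_box(1)[OF assms(1)] mesh_box(2)[OF assms(1), of 0] assms(3) by simp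

context
  fixes K :: element and m :: nat and y :: point
  assumes K: "K \<in> mesh S" and m: "m \<le> space_dim S"
    and y: "y \<in> lg_points S K ({0..space_dim S} - {m})"
begin

lemma face_value_admissible:
  assumes "\<xi> \<in> lgl_nodes (lgl_num S m)"
  shows "admissible S (y(m := ref_to_cell K m \<xi>)) (U K (y(m := ref_to_cell K m \<xi>)))"
  by (rule interior[OF K lg_points_S_tilde[OF y m assms]])

text \<open>A neighbour sees the common face at its reference node -1, which is an LGL node, so the
  trace is one of its own nodal values. The argument applies to whichever neighbour
  \<open>SOME\<close> picks.\<close>

lemma trace_above_admissible:
  "admissible S (y(m := hi K m)) (trace_above S U g K m (y(m := hi K m)))"
proof (cases "\<exists>K'\<in>mesh S. above (space_dim S) m K K'")
  case True
  define K' where "K' = (SOME K'. K' \<in> mesh S \<and> above (space_dim S) m K K')"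
  have K': "K' \<in> mesh S" "above (space_dim S) m K K'"
    using True someI_ex[of "\<lambda>K'. K' \<in> mesh S \<and> above (space_dim S) m K K'"]
    by (auto simp: K'_def)
  have "lg_points S K' ({0..space_dim S} - {m}) = lg_points S K ({0..space_dim S} - {m})"
    using K'(2) by (intro lg_points_cong) (auto simp: above_def)
  then have "y(m := ref_to_cell K' m (- 1)) \<in> S_tilde S K'"
    using y by (intro lg_points_S_tilde m lgl_nodes_ends) simp
  then have "y(m := hi K m) \<in> S_tilde S K'"
    using K'(2) by (simp add: above_def)
  then have "admissible S (y(m := hi K m)) (U K' (y(m := hi K m)))" by (rule interior[OF K'(1)])
  then show ?thesis using True by (simp add: trace_above_def K'_def)
next
  case False
  have "y(m := hi K m) \<in> closed_cell (space_dim S) K"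
    using mesh_box(2)[OF K] m by (intro lg_points_closed_cell[OF y]) (auto intro: less_imp_le)
  then have "y(m := hi K m) \<in> boundary_points S"
    using False K m unfolding boundary_points_def by (auto intro!: bexI[of _ K] bexI[of _ m])
  then show ?thesis unfolding trace_above_def if_not_P[OF False] by (rule exterior)
qed

lemma trace_below_admissible:
  "admissible S (y(m := lo K m)) (trace_below S U g K m (y(m := lo K m)))"
proof (cases "\<exists>K'\<in>mesh S. above (space_dim S) m K' K")
  case True
  define K' where "K' = (SOME K'. K' \<in> mesh S \<and> above (space_dim S) m K' K)"
  have K': "K' \<in> mesh S" "above (space_dim S) m K' K"
    using True someI_ex[of "\<lambda>K'. K' \<in> mesh S \<and> above (space_dim S) m K' K"]
    by (auto simp: K'_def)
  have "lg_points S K' ({0..space_dim S} - {m}) = lg_points S K ({0..space_dim S} - {m})"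
    using K'(2) by (intro lg_points_cong) (auto simp: above_def)
  then have "y(m := ref_to_cell K' m 1) \<in> S_tilde S K'"
    using y by (intro lg_points_S_tilde m lgl_nodes_ends) simp
  then have "y(m := lo K m) \<in> S_tilde S K'"
    using K'(2) by (simp add: above_def)
  then have "admissible S (y(m := lo K m)) (U K' (y(m := lo K m)))" by (rule interior[OF K'(1)])
  then show ?thesis using True by (simp add: trace_below_def K'_def)
next
  case False
  have "y(m := lo K m) \<in> closed_cell (space_dim S) K"
    using mesh_box(2)[OF K] m by (intro lg_points_closed_cell[OF y]) (auto intro: less_imp_le)
  then have "y(m := lo K m) \<in> boundary_points S"
    using False K m unfolding boundary_points_def by (auto intro!: bexI[of _ K] bexI[of _ m])
  then show ?thesis unfolding trace_below_def if_not_P[OF False] by (rule exterior)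
qed

end

text \<open>The share splits into upper face, lower face and interior nodes. The factor \<epsilon>^2
  is left out: it is common to average and flux and positive at the quadrature points.\<close>

lemma spatial_bracket_realizable:
  assumes vel: "\<And>x. norm (vel S x) < 1" and M: "2 \<le> lgl_num_x S"
    and K: "K \<in> mesh S" and l: "l \<in> {1..space_dim S}" and a: "1 \<le> speed_x S l"
    and \<mu>: "0 \<le> \<mu>"
    and cfl: "\<mu> * ((real (space_dim S) + 1) * speed_x S l) \<le> lgl_weight (lgl_num_x S) 1 * width K l"
    and y: "y \<in> lg_points S K ({0..space_dim S} - {l})"
  shows "(1 / (real (space_dim S) + 1)) *\<^sub>R width K l *\<^sub>R
      (\<Sum>\<xi>\<in>lgl_nodes (lgl_num_x S). lgl_weight (lgl_num_x S) \<xi> *\<^sub>R U K (y(l := ref_to_cell K l \<xi>)))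
    - \<mu> *\<^sub>R (face_flux_x_hi S U g K l y - face_flux_x_lo S U g K l y) \<in> realizable"
proof -
  let ?M = "lgl_num_x S" and ?D = "real (space_dim S) + 1"
  let ?V = "\<lambda>\<xi>. U K (y(l := ref_to_cell K l \<xi>))"
  \<comment> \<open>The weight of an end node in this share of the average, to be compared with the
    dissipation \<mu> a.\<close>
  define c where "c = lgl_weight ?M 1 * width K l / ?D"
  have w: "0 < width K l" using mesh_box(2)[OF K, of l] l by (simp add: width_def)
  have c: "0 < c" using w lgl_weight_1_pos[OF M] by (simp add: c_def)
  have cfl': "\<mu> * speed_x S l \<le> c" using cfl by (simp add: c_def field_simps)
  have l': "l \<le> space_dim S" "0 < l" using l by auto
  have pos: "0 < (y(l := t)) 0" for t using lg_points_eps_pos[OF K y l'(2)] l'(2) by simp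
  have adm: "admissible S (y(l := ref_to_cell K l \<xi>)) (?V \<xi>)" if "\<xi> \<in> lgl_nodes ?M" for \<xi>
    using face_value_admissible[OF K l'(1) y] that l'(2) by (simp add: lgl_num_def)
  have hi: "c *\<^sub>R ?V 1 - \<mu> *\<^sub>R face_flux_x_hi S U g K l y \<in> realizable"
    unfolding face_flux_x_hi_def Let_def ref_to_cell_1
    by (intro numflux_x_realizable(1) trace_above_admissible[OF K l'(1) y]
        adm[OF lgl_nodes_ends(1), unfolded ref_to_cell_1] pos vel l'(2) a c \<mu> cfl')
  have lo: "c *\<^sub>R ?V (- 1) + \<mu> *\<^sub>R face_flux_x_lo S U g K l y \<in> realizable"
    unfolding face_flux_x_lo_def Let_def ref_to_cell_minus_1
    by (intro numflux_x_realizable(2) trace_below_admissible[OF K l'(1) y]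
        adm[OF lgl_nodes_ends(2), unfolded ref_to_cell_minus_1] pos vel l'(2) a c \<mu> cfl')
  define R where "R = (\<Sum>\<xi>\<in>lgl_nodes ?M - {1, - 1}. lgl_weight ?M \<xi> *\<^sub>R ?V \<xi>)"
  have "R \<in> light_cone"
    unfolding R_def using M adm
    by (intro light_cone_sum light_cone_scaleR lgl_weight_nonneg)
       (auto simp: admissible_def intro: realizable_light_cone)
  then have "(c *\<^sub>R ?V 1 - \<mu> *\<^sub>R face_flux_x_hi S U g K l y)
      + (c *\<^sub>R ?V (- 1) + \<mu> *\<^sub>R face_flux_x_lo S U g K l y) + (width K l / ?D) *\<^sub>R R \<in> realizable"
    using w by (intro realizable_add[OF realizable_add[OF hi realizable_light_cone[OF lo]]] light_cone_scaleR) auto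
  then show ?thesis
    unfolding sum_lgl_nodes[OF M] R_def[symmetric]
    by (simp add: lgl_weight_minus c_def algebra_simps)
qed

lemma spectral_bracket_light_cone:
  assumes vel: "\<And>x. norm (vel S x) < 1" and M: "2 \<le> lgl_num_eps S"
    and K: "K \<in> mesh S" and \<mu>: "0 \<le> \<mu>"
    and speed: "\<And>x \<epsilon> \<omega>. x \<in> space_cell (space_dim S) K \<Longrightarrow> 0 < \<epsilon> \<Longrightarrow> \<omega> \<in> angles \<Longrightarrow>
        \<bar>qfun (vel S x) (grad_u S x) \<epsilon> \<omega>\<bar> \<le> speed_eps S x"
    and cfl: "\<And>x. x \<in> space_cell (space_dim S) K \<Longrightarrow>
        \<mu> * ((real (space_dim S) + 1) * hi K 0 * speed_eps S x)
        \<le> lorentz (vel S x) * (1 - norm (vel S x)) * (lgl_weight (lgl_num_eps S) 1 * width K 0)"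
    and y: "y \<in> lg_points S K ({0..space_dim S} - {0})"
  shows "(1 / (real (space_dim S) + 1)) *\<^sub>R width K 0 *\<^sub>R
      (\<Sum>\<xi>\<in>lgl_nodes (lgl_num_eps S). (lgl_weight (lgl_num_eps S) \<xi> * (ref_to_cell K 0 \<xi>)\<^sup>2) *\<^sub>R
         U K (y(0 := ref_to_cell K 0 \<xi>)))
    - \<mu> *\<^sub>R ((hi K 0)^3 *\<^sub>R face_flux_eps_hi S U g K y - (lo K 0)^3 *\<^sub>R face_flux_eps_lo S U g K y)
    \<in> light_cone"
proof -
  let ?M = "lgl_num_eps S" and ?D = "real (space_dim S) + 1"
  let ?V = "\<lambda>\<xi>. U K (y(0 := ref_to_cell K 0 \<xi>))"
  define x where "x = space_part (space_dim S) y"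
  have x: "space_part (space_dim S) (y(0 := t)) = x" for t
    by (auto simp: x_def space_part_def)
  have xK: "x \<in> space_cell (space_dim S) K"
    using lg_points_space_cell[OF y mesh_box(2)[OF K]] unfolding x by simp
  define c where "c = lgl_weight ?M 1 * width K 0 / ?D"
  have w: "0 < width K 0" using mesh_box(2)[OF K, of 0] by (simp add: width_def)
  have c: "0 \<le> c" using w lgl_weight_1_pos[OF M] by (simp add: c_def)
  \<comment> \<open>Any sample of |q| bounds the speed from below by 0; \<epsilon> = 1 and the pole
    (0, 0) serve.\<close>
  have a: "0 \<le> speed_eps S x"
    using speed[OF xK, of 1 "(0, 0)"] by (force simp: angles_def)
  have cfl_hi: "\<mu> * hi K 0 * speed_eps S x \<le> c * (lorentz (vel S x) * (1 - norm (vel S x)))"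
    using cfl[OF xK] by (simp add: c_def field_simps)
  \<comment> \<open>The lower face has the smaller energy, so the bound with \<open>hi K 0\<close>
    covers both faces.\<close>
  have "\<mu> * lo K 0 * speed_eps S x \<le> \<mu> * hi K 0 * speed_eps S x"
    using mesh_box(2)[OF K, of 0] \<mu> a by (intro mult_right_mono mult_left_mono) auto
  then have cfl_lo: "\<mu> * lo K 0 * speed_eps S x \<le> c * (lorentz (vel S x) * (1 - norm (vel S x)))"
    using cfl_hi by simp
  have adm: "admissible S (y(0 := ref_to_cell K 0 \<xi>)) (?V \<xi>)" if "\<xi> \<in> lgl_nodes ?M" for \<xi>
    using face_value_admissible[OF K _ y] that by (simp add: lgl_num_def)
  have e: "0 \<le> lo K 0" "0 < hi K 0" using mesh_box(1)[OF K] mesh_box(2)[OF K, of 0] by auto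
  \<comment> \<open>Of the flux factor \<epsilon>^3 one power joins \<mu>; the other two match the
    weight \<epsilon>^2 of the average and are multiplied back afterwards.\<close>
  have "c *\<^sub>R ?V 1 - (\<mu> * hi K 0) *\<^sub>R face_flux_eps_hi S U g K y \<in> light_cone"
    unfolding face_flux_eps_hi_def Let_def ref_to_cell_1
    by (rule numflux_eps_light_cone(1))
       (use adm[OF lgl_nodes_ends(1)] trace_above_admissible[OF K _ y] vel speed[OF xK] cfl_hi c \<mu> e
         in \<open>simp_all add: x\<close>)
  then have "(hi K 0)\<^sup>2 *\<^sub>R (c *\<^sub>R ?V 1 - (\<mu> * hi K 0) *\<^sub>R face_flux_eps_hi S U g K y) \<in> light_cone"
    by (rule light_cone_scaleR) simp
  then have hi: "(c * (hi K 0)\<^sup>2) *\<^sub>R ?V 1 - (\<mu> * (hi K 0)^3) *\<^sub>R face_flux_eps_hi S U g K y \<in> light_cone"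
    by (simp add: scaleR_diff_right power2_eq_square power3_eq_cube mult_ac)
  \<comment> \<open>At \<open>lo K 0 = 0\<close> there is no closure with which to estimate the
    flux, but both terms carry a factor 0.\<close>
  have lo: "(c * (lo K 0)\<^sup>2) *\<^sub>R ?V (- 1) + (\<mu> * (lo K 0)^3) *\<^sub>R face_flux_eps_lo S U g K y \<in> light_cone"
  proof (cases "lo K 0 = 0")
    case True
    then show ?thesis by simp
  next
    case False
    have "c *\<^sub>R ?V (- 1) + (\<mu> * lo K 0) *\<^sub>R face_flux_eps_lo S U g K y \<in> light_cone"
      unfolding face_flux_eps_lo_def Let_def ref_to_cell_minus_1
      by (rule numflux_eps_light_cone(2))
         (use adm[OF lgl_nodes_ends(2)] trace_below_admissible[OF K _ y] vel speed[OF xK] cfl_lo c \<mu> e False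
           in \<open>simp_all add: x\<close>)
    then have "(lo K 0)\<^sup>2 *\<^sub>R (c *\<^sub>R ?V (- 1) + (\<mu> * lo K 0) *\<^sub>R face_flux_eps_lo S U g K y) \<in> light_cone"
      by (rule light_cone_scaleR) simp
    then show ?thesis
      by (simp add: scaleR_add_right power2_eq_square power3_eq_cube mult_ac)
  qed
  define R where "R = (\<Sum>\<xi>\<in>lgl_nodes ?M - {1, - 1}. (lgl_weight ?M \<xi> * (ref_to_cell K 0 \<xi>)\<^sup>2) *\<^sub>R ?V \<xi>)"
  have "R \<in> light_cone"
    unfolding R_def using M adm
    by (intro light_cone_sum light_cone_scaleR mult_nonneg_nonneg lgl_weight_nonneg)
       (auto simp: admissible_def intro: realizable_light_cone)
  then have "((c * (hi K 0)\<^sup>2) *\<^sub>R ?V 1 - (\<mu> * (hi K 0)^3) *\<^sub>R face_flux_eps_hi S U g K y)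
      + ((c * (lo K 0)\<^sup>2) *\<^sub>R ?V (- 1) + (\<mu> * (lo K 0)^3) *\<^sub>R face_flux_eps_lo S U g K y)
      + (width K 0 / ?D) *\<^sub>R R \<in> light_cone"
    using w by (intro light_cone_add[OF light_cone_add[OF hi lo]] light_cone_scaleR) auto
  then show ?thesis
    unfolding sum_lgl_nodes[OF M] R_def[symmetric]
    by (simp add: lgl_weight_minus c_def algebra_simps)
qed

end

section \<open>Stage update\<close>

text \<open>Each flux difference needs an average whose nodes include its own pair of faces, and no
  single one of these quadratures does this for all coordinates. The equal shares are the origin of
  d + 1 in the time step.\<close>

lemma substage_decomposition:
  fixes S :: dg_scheme and U :: "nat \<Rightarrow> field" and g :: "nat \<Rightarrow> point \<Rightarrow> state" and K :: element
    and chat :: "nat \<Rightarrow> nat \<Rightarrow> real" and dt :: real and i j :: nat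
  defines "d \<equiv> space_dim S"
  defines "\<mu> \<equiv> chat i j * dt"
  assumes lg: "lg_exact (lg_num S) (k + 2)"
    and poly: "tensor_polynomial d k (U j K)"
    and box: "\<And>m. m \<le> d \<Longrightarrow> lo K m < hi K m" and eps: "0 \<le> lo K 0"
    and lgl_x: "\<And>l. l \<in> {1..d} \<Longrightarrow> lgl_exact_x S (U j) K l"
    and lgl_eps: "lgl_exact_eps S (U j) K"
  shows "volume d K *\<^sub>R substage S chat dt U g i j K
    = lg_quad S K ({0..d} - {0}) (\<lambda>y.
        (1 / (real d + 1)) *\<^sub>R width K 0 *\<^sub>R
          (\<Sum>\<xi>\<in>lgl_nodes (lgl_num_eps S). (lgl_weight (lgl_num_eps S) \<xi> * (ref_to_cell K 0 \<xi>)\<^sup>2) *\<^sub>R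
             U j K (y(0 := ref_to_cell K 0 \<xi>)))
        - \<mu> *\<^sub>R ((hi K 0)^3 *\<^sub>R face_flux_eps_hi S (U j) (g j) K y
            - (lo K 0)^3 *\<^sub>R face_flux_eps_lo S (U j) (g j) K y))
    + (\<Sum>l\<in>{1..d}. lg_quad S K ({0..d} - {l}) (\<lambda>y. (y 0)\<^sup>2 *\<^sub>R
        ((1 / (real d + 1)) *\<^sub>R width K l *\<^sub>R
          (\<Sum>\<xi>\<in>lgl_nodes (lgl_num_x S). lgl_weight (lgl_num_x S) \<xi> *\<^sub>R U j K (y(l := ref_to_cell K l \<xi>)))
        - \<mu> *\<^sub>R (face_flux_x_hi S (U j) (g j) K l y - face_flux_x_lo S (U j) (g j) K l y))))"
    (is "_ = lg_quad _ _ _ (\<lambda>y. ?e *\<^sub>R ?A y - _ *\<^sub>R ?F y)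
      + (\<Sum>l\<in>_. lg_quad _ _ _ (\<lambda>y. _ *\<^sub>R (_ *\<^sub>R ?B l y - _ *\<^sub>R ?G l y)))")
proof -
  let ?vol = "volume d K" and ?avg = "cell_average d (U j) K"
  note hyps = lg poly[unfolded d_def] box[unfolded d_def] eps
  have vol: "?vol \<noteq> 0"
    using volume_pos[where S = S and U = "U j" and K = K and k = k, OF hyps] by (simp add: d_def)
  have A: "lg_quad S K ({0..d} - {0}) ?A = ?vol *\<^sub>R ?avg"
    using cell_average_lgl_eps[where S = S and U = "U j" and K = K and k = k, OF hyps lgl_eps]
    by (simp add: d_def)
  have B: "lg_quad S K ({0..d} - {l}) (\<lambda>y. (y 0)\<^sup>2 *\<^sub>R ?B l y) = ?vol *\<^sub>R ?avg" if "l \<in> {1..d}" for l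
    using cell_average_lgl_x[where S = S and U = "U j" and K = K and k = k, OF hyps, of l] lgl_x[OF that] that
    by (simp add: d_def)
  let ?QF = "lg_quad S K ({0..d} - {0}) ?F"
  let ?QG = "\<lambda>l. lg_quad S K ({0..d} - {l}) (\<lambda>y. (y 0)\<^sup>2 *\<^sub>R ?G l y)"
  have first: "lg_quad S K ({0..d} - {0}) (\<lambda>y. ?e *\<^sub>R ?A y - \<mu> *\<^sub>R ?F y)
    = ?e *\<^sub>R ?vol *\<^sub>R ?avg - \<mu> *\<^sub>R ?QF"
    by (simp only: lg_quad_lincomb[where h = ?A and h' = ?F] A)
  have swap: "(\<lambda>y. (y 0)\<^sup>2 *\<^sub>R (?e *\<^sub>R ?B l y - \<mu> *\<^sub>R ?G l y))
    = (\<lambda>y. ?e *\<^sub>R (y 0)\<^sup>2 *\<^sub>R ?B l y - \<mu> *\<^sub>R (y 0)\<^sup>2 *\<^sub>R ?G l y)" for l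
    by (simp only: scaleR_diff_right scaleR_left_commute[of "(_ 0)\<^sup>2"])
  have rest: "(\<Sum>l\<in>{1..d}. lg_quad S K ({0..d} - {l}) (\<lambda>y. (y 0)\<^sup>2 *\<^sub>R (?e *\<^sub>R ?B l y - \<mu> *\<^sub>R ?G l y)))
    = (\<Sum>l\<in>{1..d}. ?e *\<^sub>R ?vol *\<^sub>R ?avg - \<mu> *\<^sub>R ?QG l)"
  proof (rule sum.cong[OF refl])
    fix l assume l: "l \<in> {1..d}"
    show "lg_quad S K ({0..d} - {l}) (\<lambda>y. (y 0)\<^sup>2 *\<^sub>R (?e *\<^sub>R ?B l y - \<mu> *\<^sub>R ?G l y))
      = ?e *\<^sub>R ?vol *\<^sub>R ?avg - \<mu> *\<^sub>R ?QG l"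
      unfolding swap
      by (simp only: lg_quad_lincomb[where h = "\<lambda>y. (y 0)\<^sup>2 *\<^sub>R ?B l y" and h' = "\<lambda>y. (y 0)\<^sup>2 *\<^sub>R ?G l y"] B[OF l])
  qed
  have sets: "{0..d} - {0} = {1..d}" by auto
  have "transport S (U j) (g j) K = - (1 / ?vol) *\<^sub>R (?QF + (\<Sum>l\<in>{1..d}. ?QG l))"
    unfolding sets transport_def d_def[symmetric]
    by (simp add: scaleR_add_right scaleR_sum_right sum_negf)
  then have tr: "?vol *\<^sub>R transport S (U j) (g j) K = - (?QF + (\<Sum>l\<in>{1..d}. ?QG l))"
    using vol by (simp only:) simp
  have "?vol *\<^sub>R substage S chat dt U g i j K
    = ?vol *\<^sub>R ?avg + \<mu> *\<^sub>R ?vol *\<^sub>R transport S (U j) (g j) K"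
    by (simp add: substage_def \<mu>_def d_def scaleR_add_right mult.commute)
  also have "\<dots> = ?vol *\<^sub>R ?avg - \<mu> *\<^sub>R (?QF + (\<Sum>l\<in>{1..d}. ?QG l))"
    by (simp only: tr scaleR_minus_right add_uminus_conv_diff)
  also have "\<dots> = (?e *\<^sub>R ?vol *\<^sub>R ?avg - \<mu> *\<^sub>R ?QF) + (\<Sum>l\<in>{1..d}. ?e *\<^sub>R ?vol *\<^sub>R ?avg - \<mu> *\<^sub>R ?QG l)"
  proof -
    have share: "(real d + 1) *\<^sub>R X = X + (\<Sum>l\<in>{1..d}. X)" for X :: state
      by (simp add: scaleR_left_distrib sum_constant_scaleR add.commute)
    have "?vol *\<^sub>R ?avg = (real d + 1) *\<^sub>R ?e *\<^sub>R ?vol *\<^sub>R ?avg" by simp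
    also note share
    \<comment> \<open>Only the isolated copy of the average may be expanded; the right-hand side
      contains it too, so the substitution is pinned to one position.\<close>
    finally show ?thesis
      by (rule ssubst[where P = "\<lambda>X. X - _ = _"])
        (simp only: sum_subtractf scaleR_add_right scaleR_sum_right add_diff_add)
  qed
  finally show ?thesis unfolding first rest .
qed

text \<open>The multiplied form of the conclusion covers the cases \<open>chat i j = 0\<close> and
  \<open>B = 0\<close>, where a quotient may be infinite and the left-hand side is 0. Otherwise all
  quotients involved are real.\<close>

lemma time_step_bound:
  assumes chat: "\<And>m j. 1 \<le> m \<Longrightarrow> m \<le> s \<Longrightarrow> j < m \<Longrightarrow> 0 \<le> chat m j"
    and ij: "1 \<le> i" "i \<le> s" "j < i"
    and dt: "ereal dt \<le> ssp_factor s chat * cfl_bound S"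
    and cfl: "0 \<le> cfl_bound S" "cfl_bound S \<le> ereal A / ereal B" and AB: "0 \<le> A" "0 \<le> B"
  shows "chat i j * dt * B \<le> A"
proof (cases "chat i j = 0 \<or> B = 0")
  case True
  then show ?thesis using AB by auto
next
  case False
  then have pos: "0 < chat i j" "0 < B" using chat[OF ij] AB by auto
  have fin: "finite {1 / ereal (chat i j) | i j. 1 \<le> i \<and> i \<le> s \<and> j < i}"
  proof (rule finite_subset)
    show "{1 / ereal (chat i j) | i j. 1 \<le> i \<and> i \<le> s \<and> j < i}
      \<subseteq> (\<lambda>(i, j). 1 / ereal (chat i j)) ` ({..s} \<times> {..s})" by force
  qed simp
  have "1 / ereal (chat i j) \<in> {1 / ereal (chat i j) | i j. 1 \<le> i \<and> i \<le> s \<and> j < i}"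
    using ij by blast
  then have "ssp_factor s chat \<le> 1 / ereal (chat i j)"
    unfolding ssp_factor_def by (rule Min_le[OF fin])
  then have "ssp_factor s chat * cfl_bound S \<le> 1 / ereal (chat i j) * (ereal A / ereal B)"
    using cfl pos by (intro ereal_mult_mono) auto
  then have "ereal dt \<le> 1 / ereal (chat i j) * (ereal A / ereal B)"
    using dt by (rule order_trans[rotated])
  also have "\<dots> = ereal (1 / chat i j * (A / B))"
    using pos by (simp add: one_ereal_def)
  finally show ?thesis using pos by (simp add: field_simps)
qed

theorem proposition5:
  fixes S :: dg_scheme
    and U :: "nat \<Rightarrow> field"
    and g :: "nat \<Rightarrow> point \<Rightarrow> state"
    and c chat :: "nat \<Rightarrow> nat \<Rightarrow> real"
    and dt :: real
    and s i :: nat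
  assumes dim: "1 \<le> space_dim S" "space_dim S \<le> 3"
    and mesh: "valid_mesh (space_dim S) (mesh S)"
    and lgl_num: "2 * lgl_num_eps S \<ge> polydeg S + 5" "2 * lgl_num_x S \<ge> polydeg S + 3"
    and lg: "lg_exact (lg_num S) (polydeg S + 2)"
    and vel: "\<And>x. norm (vel S x) < 1"
    and stage: "1 \<le> i" "i \<le> s"
    and c: "\<And>m j. 1 \<le> m \<Longrightarrow> m \<le> s \<Longrightarrow> j < m \<Longrightarrow> c m j \<ge> 0"
           "\<And>m. 1 \<le> m \<Longrightarrow> m \<le> s \<Longrightarrow> (\<Sum>j<m. c m j) = 1"
    and chat: "\<And>m j. 1 \<le> m \<Longrightarrow> m \<le> s \<Longrightarrow> j < m \<Longrightarrow> chat m j \<ge> 0"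
    and poly: "\<And>j K. j < i \<Longrightarrow> K \<in> mesh S \<Longrightarrow> tensor_polynomial (space_dim S) (polydeg S) (U j K)"
    and closure: "\<And>j K z. j < i \<Longrightarrow> K \<in> mesh S \<Longrightarrow> z \<in> S_tilde S K \<Longrightarrow> 0 < z 0 \<Longrightarrow>
                    U j K z \<in> realizable \<Longrightarrow> exact_closure S z (U j K z)"
    and boundary: "\<And>j z. j < i \<Longrightarrow> z \<in> boundary_points S \<Longrightarrow> g j z \<in> realizable"
    and boundary_closure: "\<And>j z. j < i \<Longrightarrow> z \<in> boundary_points S \<Longrightarrow> 0 < z 0 \<Longrightarrow>
                    exact_closure S z (g j z)"
    and lgl_x: "\<And>j K l. j < i \<Longrightarrow> K \<in> mesh S \<Longrightarrow> l \<in> {1..space_dim S} \<Longrightarrow> lgl_exact_x S (U j) K l"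
    and lgl_eps: "\<And>j K. j < i \<Longrightarrow> K \<in> mesh S \<Longrightarrow> lgl_exact_eps S (U j) K"
    and nodal_values: "\<And>j K z. j < i \<Longrightarrow> K \<in> mesh S \<Longrightarrow> z \<in> S_tilde S K \<Longrightarrow> U j K z \<in> realizable"
    and speed_eps: "\<And>K x \<epsilon> \<omega>. K \<in> mesh S \<Longrightarrow> x \<in> space_cell (space_dim S) K \<Longrightarrow> 0 < \<epsilon> \<Longrightarrow>
                    \<omega> \<in> angles \<Longrightarrow> speed_eps S x \<ge> \<bar>qfun (vel S x) (grad_u S x) \<epsilon> \<omega>\<bar>"
    and speed_x: "\<And>l. l \<in> {1..space_dim S} \<Longrightarrow> speed_x S l \<ge> 1"
    and dt: "0 < dt" "ereal dt \<le> ssp_factor s chat * cfl_bound S"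
  shows "\<forall>K\<in>mesh S. explicit_update S c chat dt U g i K \<in> realizable"
proof
  fix K assume K: "K \<in> mesh S"
  let ?d = "space_dim S"
  have box: "lo K m < hi K m" if "m \<le> ?d" "K \<in> mesh S" for m K
    using mesh that by (auto simp: valid_mesh_def)
  have eps: "0 \<le> lo K 0" if "K \<in> mesh S" for K
    using mesh that by (auto simp: valid_mesh_def)
  have M: "2 \<le> lgl_num_eps S" "2 \<le> lgl_num_x S" using lgl_num by auto
  have w: "0 < width K m" if "m \<le> ?d" "K \<in> mesh S" for m K using box[OF that] by (simp add: width_def)
  have hi: "0 < hi K 0" if "K \<in> mesh S" for K using box[of 0, OF _ that] eps[OF that] by simp
  have speed0: "0 \<le> speed_eps S x" if "K \<in> mesh S" "x \<in> space_cell ?d K" for K x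
    using speed_eps[OF that, of 1 "(0, 0)"] by (force simp: angles_def)
  have num_eps: "0 \<le> lorentz (vel S x) * (1 - norm (vel S x)) * (lgl_weight (lgl_num_eps S) 1 * width K 0)"
    if "K \<in> mesh S" for K x
    using vel[of x] lorentz_pos[OF vel] lgl_weight_1_pos[OF M(1)] w[of 0, OF _ that]
    by (simp add: less_imp_le)
  have den_eps: "0 \<le> (real ?d + 1) * hi K 0 * speed_eps S x"
    if "K \<in> mesh S" "x \<in> space_cell ?d K" for K x
    using hi[OF that(1)] speed0[OF that] by simp
  have num_x: "0 \<le> lgl_weight (lgl_num_x S) 1 * width K l" if "K \<in> mesh S" "l \<in> {1..?d}" for K l
    using lgl_weight_1_pos[OF M(2)] w[OF _ that(1), of l] that by (simp add: less_imp_le)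
  have den_x: "0 \<le> (real ?d + 1) * speed_x S l" if "l \<in> {1..?d}" for l
    using speed_x[OF that] by simp
  \<comment> \<open>Monotonicity of extended-real products is available for nonnegative factors, so
    the sign of the infimum is settled first.\<close>
  have cfl0: "0 \<le> cfl_bound S"
    unfolding cfl_bound_def
    by (intro INF_greatest min.boundedI zero_le_divide_ereal)
       (simp_all only: ereal_less_eq(5) num_eps den_eps num_x den_x)
  have cfl_K: "cfl_bound S \<le> min
     (INF x\<in>space_cell ?d K.
        ereal (lorentz (vel S x) * (1 - norm (vel S x)) * (lgl_weight (lgl_num_eps S) 1 * width K 0))
        / ereal ((real ?d + 1) * hi K 0 * speed_eps S x))
     (INF l\<in>{1..?d}. ereal (lgl_weight (lgl_num_x S) 1 * width K l) / ereal ((real ?d + 1) * speed_x S l))"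
    unfolding cfl_bound_def by (rule INF_lower) fact
  have sub: "substage S chat dt U g i j K \<in> realizable" if j: "j < i" for j
  proof -
    define \<mu> where "\<mu> = chat i j * dt"
    have \<mu>: "0 \<le> \<mu>" using chat[OF stage j] dt(1) by (simp add: \<mu>_def)
    have cfl_eps: "\<mu> * ((real ?d + 1) * hi K 0 * speed_eps S x)
        \<le> lorentz (vel S x) * (1 - norm (vel S x)) * (lgl_weight (lgl_num_eps S) 1 * width K 0)"
      if "x \<in> space_cell ?d K" for x
    proof -
      have "cfl_bound S
          \<le> ereal (lorentz (vel S x) * (1 - norm (vel S x)) * (lgl_weight (lgl_num_eps S) 1 * width K 0))
            / ereal ((real ?d + 1) * hi K 0 * speed_eps S x)"
        using order_trans[OF cfl_K min.cobounded1] that by (rule order_trans[OF _ INF_lower])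
      then show ?thesis
        unfolding \<mu>_def
        by (intro time_step_bound[OF _ stage j dt(2) cfl0 _ num_eps[OF K] den_eps[OF K that]] chat)
    qed
    have cfl_x: "\<mu> * ((real ?d + 1) * speed_x S l) \<le> lgl_weight (lgl_num_x S) 1 * width K l"
      if "l \<in> {1..?d}" for l
    proof -
      have "cfl_bound S \<le> ereal (lgl_weight (lgl_num_x S) 1 * width K l) / ereal ((real ?d + 1) * speed_x S l)"
        using order_trans[OF cfl_K min.cobounded2] that by (rule order_trans[OF _ INF_lower])
      then show ?thesis
        unfolding \<mu>_def
        by (intro time_step_bound[OF _ stage j dt(2) cfl0 _ num_x[OF K that] den_x[OF that]] chat)
    qed
    have interior: "admissible S z (U j K z)" if "K \<in> mesh S" "z \<in> S_tilde S K" for K z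
      using nodal_values[OF j that] closure[OF j that] by (simp add: admissible_def)
    have exterior: "admissible S z (g j z)" if "z \<in> boundary_points S" for z
      using boundary[OF j that] boundary_closure[OF j that] by (simp add: admissible_def)
    note brackets = spectral_bracket_light_cone[OF mesh interior exterior vel M(1) K \<mu> _ cfl_eps]
      spatial_bracket_realizable[OF mesh interior exterior vel M(2) K _ _ \<mu> cfl_x]
    define Q0 where "Q0 = lg_quad S K ({0..?d} - {0}) (\<lambda>y.
        (1 / (real ?d + 1)) *\<^sub>R width K 0 *\<^sub>R
          (\<Sum>\<xi>\<in>lgl_nodes (lgl_num_eps S). (lgl_weight (lgl_num_eps S) \<xi> * (ref_to_cell K 0 \<xi>)\<^sup>2) *\<^sub>R
             U j K (y(0 := ref_to_cell K 0 \<xi>)))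
        - \<mu> *\<^sub>R ((hi K 0)^3 *\<^sub>R face_flux_eps_hi S (U j) (g j) K y
            - (lo K 0)^3 *\<^sub>R face_flux_eps_lo S (U j) (g j) K y))"
    define Q where "Q l = lg_quad S K ({0..?d} - {l}) (\<lambda>y. (y 0)\<^sup>2 *\<^sub>R
        ((1 / (real ?d + 1)) *\<^sub>R width K l *\<^sub>R
          (\<Sum>\<xi>\<in>lgl_nodes (lgl_num_x S). lgl_weight (lgl_num_x S) \<xi> *\<^sub>R U j K (y(l := ref_to_cell K l \<xi>)))
        - \<mu> *\<^sub>R (face_flux_x_hi S (U j) (g j) K l y - face_flux_x_lo S (U j) (g j) K l y)))" for l
    have Q0: "Q0 \<in> light_cone"
      unfolding Q0_def using box[OF _ K] speed_eps[OF K]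
      by (intro lg_quad_light_cone brackets(1)) auto
    have Q: "Q l \<in> realizable" if "l \<in> {1..?d}" for l
      unfolding Q_def
    proof (rule lg_quad_realizable[OF _ _ lg])
      fix y assume y: "y \<in> lg_points S K ({0..?d} - {l})"
      \<comment> \<open>LG points are interior, so the factor \<epsilon>^2 is positive even in a
        cell that starts at \<epsilon> = 0.\<close>
      have "0 < y 0" using lg_points_bounds(1)[OF y, of 0] box[of 0, OF _ K] eps[OF K] that by auto
      then show "(y 0)\<^sup>2 *\<^sub>R ((1 / (real ?d + 1)) *\<^sub>R width K l *\<^sub>R
          (\<Sum>\<xi>\<in>lgl_nodes (lgl_num_x S). lgl_weight (lgl_num_x S) \<xi> *\<^sub>R U j K (y(l := ref_to_cell K l \<xi>)))
        - \<mu> *\<^sub>R (face_flux_x_hi S (U j) (g j) K l y - face_flux_x_lo S (U j) (g j) K l y)) \<in> realizable"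
        using that y speed_x[OF that] by (intro realizable_scaleR brackets(2)) auto
    qed (use box[OF _ K] in auto)
    \<comment> \<open>Coordinate 1 exists because the space dimension is at least 1. Its share alone
      supplies the positive energy; the others enter as members of the closed cone.\<close>
    have "Q0 + (\<Sum>l\<in>{1..?d}. Q l) = Q 1 + (Q0 + (\<Sum>l\<in>{1..?d} - {1}. Q l))"
      using dim sum.remove[of "{1..?d}" 1 Q] by (simp add: add_ac)
    moreover have "\<dots> \<in> realizable"
      using dim by (intro realizable_add light_cone_add light_cone_sum Q Q0 realizable_light_cone) auto
    moreover have "volume ?d K *\<^sub>R substage S chat dt U g i j K = Q0 + (\<Sum>l\<in>{1..?d}. Q l)"
      unfolding Q0_def Q_def \<mu>_def
      using lgl_x[OF j K] lgl_eps[OF j K] box[OF _ K] eps[OF K]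
      by (intro substage_decomposition[where U = U and j = j, OF lg] poly j K) auto
    ultimately have scaled: "volume ?d K *\<^sub>R substage S chat dt U g i j K \<in> realizable"
      by (simp only:)
    have vol: "0 < volume ?d K"
      using box[OF _ K] by (intro volume_pos[where U = "U j", OF lg _ _ eps[OF K]] poly j K) auto
    have "(1 / volume ?d K) *\<^sub>R volume ?d K *\<^sub>R substage S chat dt U g i j K \<in> realizable"
      by (rule realizable_scaleR[OF scaled]) (simp add: vol)
    then show ?thesis using vol by simp
  qed
  show "explicit_update S c chat dt U g i K \<in> realizable"
    unfolding explicit_update_def
    by (rule realizable_weighted_sum) (use c stage sub in auto)
qed

end
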